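(* Let $\lambda\in(0,1)$, $b_\lambda(z)=\frac{z-\lambda}{1-\lambda z}$, and let $\zeta\in\mathbb{D}\setminus\{\lambda\}$. There is a constant $d=d(\lambda,\zeta)>0$, depending only on $\lambda$ and $\zeta$, such that for every $n\ge1$ $$|b_\lambda^n(\zeta)|\;\|(\zeta-T_\lambda)^{-1}\|\;\ge\; d\sqrt{n},$$ where $T_\lambda$ is the $n\times n$ Toeplitz matrix and $\|\cdot\|$ the induced matrix norm defined in the context (for which $\|T_\lambda\|\le1$).
   Context: $\mathbb{D}$ is the open unit disk. $T_\lambda$ is the $n\times n$ lower triangular Toeplitz matrix with $(T_\lambda)_{ii}=\lambda$, $(T_\lambda)_{ij}=(-\lambda)^{\,i-j-1}(1-\lambda^2)$ for $i>j$, and $(T_\lambda)_{ij}=0$ for $i<j$. The Wiener algebra is $W=\{f=\sum_{k\ge0}\hat f(k)z^k:\|f\|_W:=\sum_{k\ge0}|\hat f(k)|<\infty\}$. Let $B=b_\lambda^n$ and $e_j(z)=\frac{(1-\lambda^2)^{1/2}}{1-\lambda z}\,b_\lambda(z)^{j-1}$ for $j=1,\dots,n$. Equip $\mathbb{C}^n$ with the norm $$|x|:=\inf\Big\{\Big\|\sum_{j=1}^n x_je_j+Bg\Big\|_W : g\in W\Big\},$$ and let $\|\cdot\|$ be the operator norm on complex $n\times n$ matrices induced by $|\cdot|$. *)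

theory Defs
  imports
    "HOL-Complex_Analysis.Complex_Analysis"
    "Jordan_Normal_Form.Gauss_Jordan_Elimination"
begin

text \<open>
  Elements of the Wiener algebra are represented by total functions of which only the values
  on the open unit disk matter; the coefficients are the Taylor coefficients at the origin.
\<close>

definition wiener_coeff :: "(complex \<Rightarrow> complex) \<Rightarrow> nat \<Rightarrow> complex" where
  "wiener_coeff f k = fps_nth (fps_expansion f 0) k"

definition wiener_algebra :: "(complex \<Rightarrow> complex) set" where
  "wiener_algebra =
     {f. summable (\<lambda>k. norm (wiener_coeff f k)) \<and>
         (\<forall>z\<in>ball 0 1. (\<lambda>k. wiener_coeff f k * z ^ k) sums f z)}"

definition wiener_norm :: "(complex \<Rightarrow> complex) \<Rightarrow> real" where
  "wiener_norm f = (\<Sum>k. norm (wiener_coeff f k))"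

definition blaschke :: "real \<Rightarrow> complex \<Rightarrow> complex" where
  "blaschke l z = (z - of_real l) / (1 - of_real l * z)"

text \<open>The index \<open>j\<close> of the basis functions starts at 1.\<close>

definition basis_fun :: "real \<Rightarrow> nat \<Rightarrow> complex \<Rightarrow> complex" where
  "basis_fun l j z = of_real (sqrt (1 - l\<^sup>2)) / (1 - of_real l * z) * blaschke l z ^ (j - 1)"

text \<open>Vector entries are indexed from 0, so the \<open>j\<close>-th coordinate is entry \<open>j - 1\<close>.\<close>

definition quotient_norm :: "real \<Rightarrow> nat \<Rightarrow> complex vec \<Rightarrow> real" where
  "quotient_norm l n x =
     (INF g\<in>wiener_algebra.
        wiener_norm (\<lambda>z. (\<Sum>j=1..n. vec_index x (j - 1) * basis_fun l j z) + blaschke l z ^ n * g z))"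

definition induced_norm :: "real \<Rightarrow> nat \<Rightarrow> complex mat \<Rightarrow> real" where
  "induced_norm l n A =
     (SUP x\<in>{x \<in> carrier_vec n. quotient_norm l n x \<le> 1}. quotient_norm l n (A *\<^sub>v x))"

definition toeplitz :: "real \<Rightarrow> nat \<Rightarrow> complex mat" where
  "toeplitz l n = Matrix.mat n n (\<lambda>(i, j).
     if i = j then of_real l
     else if i > j then (- of_real l) ^ (i - j - 1) * (1 - (of_real l)\<^sup>2)
     else 0)"

end

theory Submission
  imports Defs "Jordan_Normal_Form.Determinant"
begin

text \<open>
  The space with the given norm is the quotient of the Wiener algebra by the ideal generated by
  b ^ n, where b is the Blaschke factor, and the Toeplitz matrix is multiplication by z in this
  quotient. As multiplication by z is isometric on the Wiener algebra, the matrix is a contraction.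

  In the coordinate w = b(z) the quotient consists of power series in w modulo w ^ n, and
  inverses become geometric series. In particular the resolvent at \<zeta> sends the class of the
  constant function 1, which has norm at most 1, to the vector with entries
  c / \<beta> ^ j for j < n, where \<beta> = b(\<zeta>) and c is a nonzero constant (lemma \<open>resolvent_vector\<close>). After
  multiplication by \<beta> ^ n, the difference of the entries n - 1 and n - 3 of this vector is
  c \<beta> (1 - \<beta> ^ 2), which is nonzero and does not depend on n.

  It remains to see that this difference is at most C / sqrt n times the quotient norm, for every
  vector (lemma \<open>second_difference_bound\<close>). Every coordinate of a class is a contour integral
  of a representative against a rational kernel (lemma \<open>coordinate_integral\<close>). By duality with the
  absolutely summable coefficients of the representative (lemma \<open>contour_pairing_bound\<close>) it suffices
  to bound the integrals of the monomials z ^ k against the difference of the two kernels, uniformly in k.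
  On the unit circle these are oscillatory integrals, the phase of which has derivative k - n P(t) with
  the Poisson kernel P. Their amplitude contains the factor 1 - b(z) ^ 2, which vanishes at the two
  points where the derivative of P does, so that the amplitude is dominated by the second
  derivative of the phase. For such integrals integration by parts gives the order n powr (-1/2)
  (lemmas \<open>oscillatory_integral_bound\<close> and \<open>second_difference_moments\<close>). This is why two coordinates
  are compared: a single kernel only gives n powr (-1/3).
\<close>

section \<open>The Wiener algebra\<close>

text \<open>
  The Taylor series of a function that is holomorphic in the disk automatically converges to it there,
  so membership in the algebra splits into holomorphy and summability of the coefficients.
\<close>

lemma wiener_algebra_iff:
  "f \<in> wiener_algebra \<longleftrightarrow>
     f holomorphic_on ball 0 1 \<and> summable (\<lambda>k. norm (wiener_coeff f k))"
proof
  assume f: "f \<in> wiener_algebra"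
  have "f holomorphic_on ball 0 1"
    by (rule power_series_holomorphic[where a = "wiener_coeff f"])
       (use f in \<open>auto simp: wiener_algebra_def\<close>)
  with f show "f holomorphic_on ball 0 1 \<and> summable (\<lambda>k. norm (wiener_coeff f k))"
    by (auto simp: wiener_algebra_def)
next
  assume f: "f holomorphic_on ball 0 1 \<and> summable (\<lambda>k. norm (wiener_coeff f k))"
  have "(\<lambda>k. wiener_coeff f k * z ^ k) sums f z" if "z \<in> ball 0 1" for z
    unfolding wiener_coeff_def
    by (rule has_fps_expansion_imp_sums_complex[where r = 1,
          OF has_fps_expansion_fps_expansion[of "ball 0 1"]])
       (use f that in \<open>auto simp: one_ereal_def\<close>)
  with f show "f \<in> wiener_algebra"
    by (auto simp: wiener_algebra_def)
qed

lemma wiener_has_fps_expansion: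
  "f \<in> wiener_algebra \<Longrightarrow> f has_fps_expansion fps_expansion f 0"
  by (rule has_fps_expansion_fps_expansion[of "ball 0 1"]) (auto simp: wiener_algebra_iff)

lemma wiener_coeff_eqI: "f has_fps_expansion F \<Longrightarrow> wiener_coeff f k = fps_nth F k"
  by (simp add: wiener_coeff_def fps_expansion_eqI)

lemma wiener_norm_nonneg: "f \<in> wiener_algebra \<Longrightarrow> 0 \<le> wiener_norm f"
  unfolding wiener_norm_def by (rule suminf_nonneg) (auto simp: wiener_algebra_iff)

lemma
  assumes "f \<in> wiener_algebra" "g \<in> wiener_algebra"
  shows wiener_add: "(\<lambda>z. f z + g z) \<in> wiener_algebra"
    and wiener_mult: "(\<lambda>z. f z * g z) \<in> wiener_algebra"
proof -
  have fps: "f has_fps_expansion fps_expansion f 0" "g has_fps_expansion fps_expansion g 0"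
    using assms wiener_has_fps_expansion by blast+
  have f: "f holomorphic_on ball 0 1" "summable (\<lambda>k. norm (wiener_coeff f k))"
    and g: "g holomorphic_on ball 0 1" "summable (\<lambda>k. norm (wiener_coeff g k))"
    using assms by (auto simp: wiener_algebra_iff)
  have "wiener_coeff (\<lambda>z. f z + g z) k = wiener_coeff f k + wiener_coeff g k" for k
    using wiener_coeff_eqI[OF has_fps_expansion_add[OF fps]] by (simp add: wiener_coeff_def)
  moreover have "summable (\<lambda>k. norm (wiener_coeff f k + wiener_coeff g k))"
    by (rule summable_comparison_test'[OF summable_add[OF f(2) g(2)], of 0])
       (simp add: norm_triangle_ineq)
  ultimately show "(\<lambda>z. f z + g z) \<in> wiener_algebra"
    using f g by (auto simp: wiener_algebra_iff intro!: holomorphic_intros)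
  have "wiener_coeff (\<lambda>z. f z * g z) k = (\<Sum>i\<le>k. wiener_coeff f i * wiener_coeff g (k - i))" for k
    using wiener_coeff_eqI[OF has_fps_expansion_mult[OF fps]]
    by (simp add: wiener_coeff_def fps_mult_nth atLeast0AtMost)
  moreover have "summable (\<lambda>k. norm (\<Sum>i\<le>k. wiener_coeff f i * wiener_coeff g (k - i)))"
  proof (rule summable_comparison_test'[where N = 0])
    show "summable (\<lambda>k. \<Sum>i\<le>k. norm (wiener_coeff f i) * norm (wiener_coeff g (k - i)))"
      by (rule summable_Cauchy_product) (use f g in auto)
  qed (auto intro!: order_trans[OF norm_sum] simp: norm_mult)
  ultimately show "(\<lambda>z. f z * g z) \<in> wiener_algebra"
    using f g by (auto simp: wiener_algebra_iff intro!: holomorphic_intros)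
qed

lemma wiener_const [simp]: "(\<lambda>z. c) \<in> wiener_algebra"
proof -
  have "summable (\<lambda>k. norm (wiener_coeff (\<lambda>z. c) k))"
    by (rule summable_finite[of "{0}"]) (auto simp: wiener_coeff_eqI[OF has_fps_expansion_const])
  thus ?thesis by (simp add: wiener_algebra_iff)
qed

lemma wiener_norm_const: "wiener_norm (\<lambda>z. c) = norm c"
proof -
  have "wiener_norm (\<lambda>z. c) = (\<Sum>k\<in>{0}. norm (wiener_coeff (\<lambda>z. c) k))"
    unfolding wiener_norm_def
    by (rule suminf_finite) (auto simp: wiener_coeff_eqI[OF has_fps_expansion_const])
  thus ?thesis by (simp add: wiener_coeff_eqI[OF has_fps_expansion_const])
qed

lemma
  assumes "f \<in> wiener_algebra" "g \<in> wiener_algebra"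
  shows wiener_norm_add_le: "wiener_norm (\<lambda>z. f z + g z) \<le> wiener_norm f + wiener_norm g"
    and wiener_norm_cmult: "wiener_norm (\<lambda>z. c * f z) = norm c * wiener_norm f"
proof -
  have fps: "f has_fps_expansion fps_expansion f 0" "g has_fps_expansion fps_expansion g 0"
    using assms wiener_has_fps_expansion by blast+
  have f: "summable (\<lambda>k. norm (wiener_coeff f k))" and g: "summable (\<lambda>k. norm (wiener_coeff g k))"
    and fg: "summable (\<lambda>k. norm (wiener_coeff (\<lambda>z. f z + g z) k))"
    using assms wiener_add[OF assms] by (auto simp: wiener_algebra_iff)
  have coeff: "wiener_coeff (\<lambda>z. f z + g z) k = wiener_coeff f k + wiener_coeff g k" for k
    using wiener_coeff_eqI[OF has_fps_expansion_add[OF fps]] by (simp add: wiener_coeff_def)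
  show "wiener_norm (\<lambda>z. f z + g z) \<le> wiener_norm f + wiener_norm g"
    unfolding wiener_norm_def suminf_add[OF f g]
    by (intro suminf_le summable_add f g fg) (simp add: coeff norm_triangle_ineq)
  have "wiener_coeff (\<lambda>z. c * f z) k = c * wiener_coeff f k" for k
    using wiener_coeff_eqI[OF has_fps_expansion_cmult_left[OF fps(1)]] by (simp add: wiener_coeff_def)
  thus "wiener_norm (\<lambda>z. c * f z) = norm c * wiener_norm f"
    unfolding wiener_norm_def by (simp add: norm_mult suminf_mult[OF f])
qed

lemma wiener_sum:
  "(\<And>i. i \<in> I \<Longrightarrow> f i \<in> wiener_algebra) \<Longrightarrow> (\<lambda>z. \<Sum>i\<in>I. f i z) \<in> wiener_algebra"
  by (induction I rule: infinite_finite_induct) (auto intro: wiener_add)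

lemma wiener_norm_sum_le:
  assumes "\<And>i. i \<in> I \<Longrightarrow> f i \<in> wiener_algebra"
  shows "wiener_norm (\<lambda>z. \<Sum>i\<in>I. c i * f i z) \<le> (\<Sum>i\<in>I. norm (c i) * wiener_norm (f i))"
  using assms
proof (induction I rule: infinite_finite_induct)
  case (insert i I)
  have "wiener_norm (\<lambda>z. c i * f i z + (\<Sum>i\<in>I. c i * f i z))
      \<le> wiener_norm (\<lambda>z. c i * f i z) + wiener_norm (\<lambda>z. \<Sum>i\<in>I. c i * f i z)"
    by (intro wiener_norm_add_le wiener_sum wiener_mult wiener_const insert.prems) auto
  moreover have "wiener_norm (\<lambda>z. c i * f i z) = norm (c i) * wiener_norm (f i)"
    by (intro wiener_norm_cmult[OF _ wiener_const] insert.prems) simp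
  ultimately show ?case using insert by simp
qed (simp_all add: wiener_norm_const)

lemma wiener_power: "f \<in> wiener_algebra \<Longrightarrow> (\<lambda>z. f z ^ n) \<in> wiener_algebra"
  by (induction n) (auto intro: wiener_mult)

lemma wiener_coeff_shift:
  assumes "f \<in> wiener_algebra"
  shows "wiener_coeff (\<lambda>z. z * f z) k = (case k of 0 \<Rightarrow> 0 | Suc m \<Rightarrow> wiener_coeff f m)"
  using wiener_coeff_eqI[OF has_fps_expansion_mult[OF has_fps_expansion_fps_X
      wiener_has_fps_expansion[OF assms]]]
  by (simp add: wiener_coeff_def split: nat.splits)

text \<open>
  Multiplication by the variable only shifts the coefficients. This isometry is the reason why the
  Toeplitz matrix is a contraction.
\<close>

lemma
  assumes "f \<in> wiener_algebra"
  shows wiener_shift: "(\<lambda>z. z * f z) \<in> wiener_algebra"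
    and wiener_norm_shift: "wiener_norm (\<lambda>z. z * f z) = wiener_norm f"
proof -
  let ?a = "\<lambda>k. norm (wiener_coeff (\<lambda>z. z * f z) k)"
  have Suc: "(\<lambda>k. ?a (Suc k)) = (\<lambda>k. norm (wiener_coeff f k))"
    by (simp add: wiener_coeff_shift[OF assms])
  have sm: "summable ?a"
    using assms by (subst summable_Suc_iff[symmetric]) (simp only: Suc wiener_algebra_iff)
  thus "(\<lambda>z. z * f z) \<in> wiener_algebra"
    using assms by (auto simp: wiener_algebra_iff intro!: holomorphic_intros)
  show "wiener_norm (\<lambda>z. z * f z) = wiener_norm f"
    using suminf_split_initial_segment[OF sm, of 1]
    by (simp add: wiener_norm_def wiener_coeff_shift[OF assms])
qed

text \<open>
  Identities between rational functions may fail at their poles, because of the convention x / 0 = 0;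
  only the values in the open disk count for the norm.
\<close>

lemma
  assumes "\<And>z. z \<in> ball 0 1 \<Longrightarrow> f z = g z"
  shows wiener_norm_cong: "wiener_norm f = wiener_norm g"
    and wiener_algebra_cong: "f \<in> wiener_algebra \<longleftrightarrow> g \<in> wiener_algebra"
proof -
  have "\<forall>\<^sub>F z in nhds 0. f z = g z"
    using assms by (intro eventually_nhds_in_open[of "ball 0 1", THEN eventually_mono]) auto
  hence *: "wiener_coeff f = wiener_coeff g"
    unfolding wiener_coeff_def by (simp add: fps_expansion_cong)
  thus "wiener_norm f = wiener_norm g" by (simp add: wiener_norm_def)
  have "f holomorphic_on ball 0 1 \<longleftrightarrow> g holomorphic_on ball 0 1"
    by (rule holomorphic_cong) (use assms in auto)
  with * show "f \<in> wiener_algebra \<longleftrightarrow> g \<in> wiener_algebra"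
    by (simp add: wiener_algebra_iff)
qed

section \<open>The Blaschke factor\<close>

lemma one_minus_mult_nonzero:
  fixes z :: complex
  assumes "0 < l" "l < 1" "norm z \<le> 1"
  shows "1 - of_real l * z \<noteq> 0"
proof
  assume "1 - of_real l * z = 0"
  hence "norm (of_real l * z) = 1" by (metis eq_iff_diff_eq_0 norm_one)
  thus False using assms mult_left_le[of "norm z" l] by (simp add: norm_mult)
qed

lemma one_minus_mult_nonzero_ball:
  fixes z :: complex
  assumes "0 < l" "norm z < 1 / l"
  shows "1 - of_real l * z \<noteq> 0"
proof
  assume "1 - of_real l * z = 0"
  hence "norm (of_real l * z) = 1" by (metis eq_iff_diff_eq_0 norm_one)
  thus False using assms by (simp add: norm_mult field_simps)
qed

lemma norm_one_minus_mult_ge: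
  fixes z :: complex
  assumes "0 < l" "l < 1" "norm z \<le> 1"
  shows "1 - l \<le> norm (1 - of_real l * z)"
proof -
  have "norm (of_real l * z) \<le> l" using assms by (simp add: norm_mult mult_left_le)
  thus ?thesis using norm_triangle_ineq2[of 1 "of_real l * z"] by simp
qed

lemma wiener_cauchy_kernel:
  assumes "0 < l" "l < 1"
  shows "(\<lambda>z. 1 / (1 - of_real l * z)) \<in> wiener_algebra"
proof -
  have hol: "(\<lambda>z. 1 / (1 - of_real l * z)) holomorphic_on ball 0 1"
    using assms one_minus_mult_nonzero by (auto intro!: holomorphic_intros)
  have "fps_conv_radius (Abs_fps (\<lambda>k. complex_of_real l ^ k)) \<ge> 1"
    unfolding fps_conv_radius_def one_ereal_def
  proof (rule conv_radius_geI_ex)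
    fix r :: real assume "0 < r" "ereal r < ereal 1"
    hence "norm (complex_of_real l * of_real r) < 1"
      using assms by (auto simp: norm_mult intro: mult_strict_mono[of l 1 r 1, simplified])
    hence "summable (\<lambda>n. (complex_of_real l * of_real r) ^ n)" by (rule summable_geometric)
    with \<open>0 < r\<close> show "\<exists>z. norm z = r \<and> summable (\<lambda>n. fps_nth (Abs_fps (\<lambda>k. complex_of_real l ^ k)) n * z ^ n)"
      by (intro exI[of _ "of_real r"]) (simp add: power_mult_distrib)
  qed
  hence "0 < fps_conv_radius (Abs_fps (\<lambda>k. complex_of_real l ^ k))"
    by (rule less_le_trans[rotated]) simp
  moreover have "eval_fps (Abs_fps (\<lambda>k. complex_of_real l ^ k)) z = 1 / (1 - of_real l * z)"
    if "z \<in> ball 0 1" for z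
  proof -
    have "norm (of_real l * z) < 1"
      using assms that by (auto simp: norm_mult intro: mult_strict_mono'[of l 1 "norm z" 1, simplified])
    hence "(\<Sum>k. (of_real l * z) ^ k) = 1 / (1 - of_real l * z)" by (rule suminf_geometric)
    thus ?thesis by (simp add: eval_fps_def power_mult_distrib)
  qed
  ultimately have "(\<lambda>z. 1 / (1 - of_real l * z)) has_fps_expansion Abs_fps (\<lambda>k. complex_of_real l ^ k)"
    unfolding has_fps_expansion_def
    by (intro conjI eventually_nhds_in_open[of "ball 0 1", THEN eventually_mono]) auto
  hence "wiener_coeff (\<lambda>z. 1 / (1 - of_real l * z)) k = of_real l ^ k" for k
    by (simp add: wiener_coeff_eqI)
  thus ?thesis using hol assms by (simp add: wiener_algebra_iff norm_power)
qed

lemma wiener_blaschke: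
  assumes "0 < l" "l < 1"
  shows "blaschke l \<in> wiener_algebra"
proof -
  have "(\<lambda>z. (z * 1 + - of_real l) * (1 / (1 - of_real l * z))) \<in> wiener_algebra"
    by (intro wiener_mult wiener_add wiener_shift wiener_const wiener_cauchy_kernel assms)
  thus ?thesis by (simp add: blaschke_def [abs_def])
qed

lemma wiener_basis_fun:
  assumes "0 < l" "l < 1"
  shows "basis_fun l j \<in> wiener_algebra"
proof -
  have "(\<lambda>z. of_real (sqrt (1 - l\<^sup>2)) * (1 / (1 - of_real l * z)) * blaschke l z ^ (j - 1)) \<in> wiener_algebra"
    by (intro wiener_mult wiener_power wiener_const wiener_cauchy_kernel wiener_blaschke assms)
  thus ?thesis by (simp add: basis_fun_def [abs_def])
qed

lemma blaschke_has_field_derivative: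
  assumes "0 < l" "l < 1" "norm z \<le> 1"
  shows "(blaschke l has_field_derivative (1 - of_real l ^ 2) / (1 - of_real l * z)\<^sup>2) (at z within S)"
  unfolding blaschke_def [abs_def]
  using one_minus_mult_nonzero[OF assms]
  by (auto intro!: derivative_eq_intros simp: power2_eq_square algebra_simps)

lemma blaschke_eq_0_iff:
  assumes "0 < l" "l < 1" "norm z \<le> 1"
  shows "blaschke l z = 0 \<longleftrightarrow> z = of_real l"
  using one_minus_mult_nonzero[OF assms] by (simp add: blaschke_def)

lemma norm_blaschke_on_circle:
  assumes "0 < l" "l < 1" "norm z = 1"
  shows "norm (blaschke l z) = 1"
proof -
  have "z * cnj z = 1" using assms(3) complex_norm_square[of z] by simp
  hence "1 - of_real l * z = z * cnj (z - of_real l)" by (simp add: algebra_simps)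
  hence "norm (1 - of_real l * z) = norm (z - of_real l)"
    using assms(3) by (simp only: norm_mult complex_mod_cnj)
  moreover have "z \<noteq> of_real l" using assms by auto
  ultimately show ?thesis
    using one_minus_mult_nonzero[OF assms(1,2), of z] assms(3)
    by (simp add: blaschke_def norm_divide)
qed

lemma norm_blaschke_less_one:
  assumes "0 < l" "l < 1" "norm z < 1"
  shows "norm (blaschke l z) < 1"
proof -
  have "(norm (1 - of_real l * z))\<^sup>2 - (norm (z - of_real l))\<^sup>2 = (1 - l\<^sup>2) * (1 - (norm z)\<^sup>2)"
  proof -
    have "(norm (1 - of_real l * z))\<^sup>2 = (1 - l * Re z)\<^sup>2 + (l * Im z)\<^sup>2"
      and "(norm (z - of_real l))\<^sup>2 = (Re z - l)\<^sup>2 + (Im z)\<^sup>2"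
      unfolding cmod_power2 by simp_all
    moreover have "(1 - l * x)\<^sup>2 + (l * y)\<^sup>2 - ((x - l)\<^sup>2 + y\<^sup>2) = (1 - l\<^sup>2) * (1 - (x\<^sup>2 + y\<^sup>2))" for x y
      by (simp add: power2_eq_square algebra_simps)
    ultimately show ?thesis by (simp only: cmod_power2)
  qed
  also have "\<dots> > 0"
  proof -
    have "l\<^sup>2 < 1" "(norm z)\<^sup>2 < 1" using assms by (simp_all add: power_less_one_iff)
    thus ?thesis by simp
  qed
  finally have "(norm (z - of_real l))\<^sup>2 < (norm (1 - of_real l * z))\<^sup>2" by simp
  hence "norm (z - of_real l) < norm (1 - of_real l * z)"
    by (rule power2_less_imp_less) simp
  moreover have "0 < norm (1 - of_real l * z)"
    using one_minus_mult_nonzero[OF assms(1,2), of z] assms(3) by simp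
  ultimately show ?thesis
    by (simp only: blaschke_def norm_divide divide_less_eq_1_pos)
qed

lemma one_minus_blaschke_square:
  assumes "1 - of_real l * z \<noteq> 0"
  shows "1 - blaschke l z ^ 2 = (1 - of_real l ^ 2) * (1 - z ^ 2) / (1 - of_real l * z) ^ 2"
  using assms by (simp add: blaschke_def power_divide divide_simps)
     (simp add: power2_eq_square algebra_simps)

lemma blaschke_partial_fraction:
  assumes "1 - of_real l * z \<noteq> 0"
  shows "(1 - of_real l ^ 2) / (1 - of_real l * z) = 1 + of_real l * blaschke l z"
  using assms by (simp add: blaschke_def divide_simps) (simp add: power2_eq_square algebra_simps)

section \<open>An oscillatory integral with degenerate stationary points\<close>

text \<open>
  A van der Corput estimate for a phase of derivative \<phi> whose second derivative \<phi>' does not change sign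
  but may vanish, as long as the amplitude is dominated by \<phi>'. The functions E and A stand for the
  oscillating factor and the amplitude. Integrating by parts against \<phi> / (\<phi> ^ 2 + N ^ 2) instead of
  1 / \<phi> makes a separate treatment of the stationary point unnecessary: each error term except the
  one with A' is at most a constant times the derivative of arctan (\<phi> / N), up to sign, divided by N,
  and arctan varies by at most \<pi>.
\<close>

lemma oscillatory_integral_bound:
  fixes \<phi> \<phi>' :: "real \<Rightarrow> real" and A A' E :: "real \<Rightarrow> complex"
  assumes "a \<le> b" "0 < N" "0 \<le> C2"
    and E: "\<And>t. t \<in> {a..b} \<Longrightarrow> (E has_vector_derivative \<i> * of_real (\<phi> t) * E t) (at t within {a..b})"
    and norm_E: "\<And>t. t \<in> {a..b} \<Longrightarrow> norm (E t) \<le> 1"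
    and A: "\<And>t. t \<in> {a..b} \<Longrightarrow> (A has_vector_derivative A' t) (at t within {a..b})"
    and \<phi>: "\<And>t. t \<in> {a..b} \<Longrightarrow> (\<phi> has_real_derivative \<phi>' t) (at t within {a..b})"
    and sgn: "\<sigma> \<in> {1, -1}" "\<And>t. t \<in> {a..b} \<Longrightarrow> \<sigma> * \<phi>' t \<ge> 0"
    and ends: "A a = 0" "A b = 0"
    and A_le: "\<And>t. t \<in> {a..b} \<Longrightarrow> norm (A t) \<le> C1"
    and A_le_curv: "\<And>t. t \<in> {a..b} \<Longrightarrow> N\<^sup>2 * norm (A t) \<le> C2 * \<bar>\<phi>' t\<bar>"
    and A'_le: "\<And>t. t \<in> {a..b} \<Longrightarrow> norm (A' t) \<le> C3"
  shows "norm (integral {a..b} (\<lambda>t. A t * E t)) \<le> (pi * (C1 + C2) + (b - a) * C3) / N"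
proof -
  (* For large \<phi> the multiplier q behaves like 1 / \<phi>, which is what integration by parts asks for;
     unlike 1 / \<phi> it stays bounded, by 1 / N, where \<phi> vanishes. *)
  define q where "q t = \<phi> t / ((\<phi> t)\<^sup>2 + N\<^sup>2)" for t
  define q' where "q' t = \<phi>' t * (N\<^sup>2 - (\<phi> t)\<^sup>2) / ((\<phi> t)\<^sup>2 + N\<^sup>2)\<^sup>2" for t
  define V where "V t = A t * E t * of_real (q t)" for t
  define V' where "V' t = A' t * E t * of_real (q t) + \<i> * of_real (\<phi> t * q t) * (A t * E t)
                          + A t * E t * of_real (q' t)" for t
  (* V' has integral zero, so R is what integration by parts leaves of i A E. *)
  define R where "R t = \<i> * (A t * E t) - V' t" for t
  have pos: "(\<phi> t)\<^sup>2 + N\<^sup>2 > 0" for t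
    using \<open>0 < N\<close> by (simp add: add_nonneg_pos)
  have q: "(q has_real_derivative q' t) (at t within {a..b})" if "t \<in> {a..b}" for t
    unfolding q_def [abs_def] q'_def using pos[of t]
    by (auto intro!: derivative_eq_intros \<phi> that simp: power2_eq_square field_simps)
  have V: "(V has_vector_derivative V' t) (at t within {a..b})" if "t \<in> {a..b}" for t
  proof -
    have "((\<lambda>t. complex_of_real (q t)) has_vector_derivative of_real (q' t)) (at t within {a..b})"
      using q[OF that] by (rule has_vector_derivative_of_real)
    from has_vector_derivative_mult[OF has_vector_derivative_mult[OF A[OF that] E[OF that]] this]
    show ?thesis unfolding V_def [abs_def] V'_def by (simp add: algebra_simps)
  qed
  have int_V: "(V' has_integral 0) {a..b}"
    using fundamental_theorem_of_calculus[OF \<open>a \<le> b\<close> V] ends by (simp add: V_def)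
  have "continuous_on {a..b} (\<lambda>t. A t * E t)"
    by (intro continuous_on_mult continuous_on_vector_derivative) (use A E in blast)+
  hence int_AE: "(\<lambda>t. A t * E t) integrable_on {a..b}"
    by (rule integrable_continuous_interval)
  have int_R: "(R has_integral \<i> * integral {a..b} (\<lambda>t. A t * E t)) {a..b}"
    unfolding R_def [abs_def]
    using has_integral_diff[OF has_integral_mult_right[OF integrable_integral[OF int_AE], of \<i>] int_V]
    by simp
  (* The variable part of the majorant D is a multiple of the derivative of arctan (\<phi> / N). *)
  define D where "D t = (C1 + C2) * (\<sigma> * \<phi>' t / ((\<phi> t)\<^sup>2 + N\<^sup>2)) + C3 / N" for t
  have int_D: "(D has_integral (C1 + C2) * (\<sigma> * arctan (\<phi> b / N) / N - \<sigma> * arctan (\<phi> a / N) / N)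
                  + (b - a) * (C3 / N)) {a..b}"
  proof -
    have "((\<lambda>t. \<sigma> * arctan (\<phi> t / N) / N) has_vector_derivative \<sigma> * \<phi>' t / ((\<phi> t)\<^sup>2 + N\<^sup>2)) (at t within {a..b})"
      if "t \<in> {a..b}" for t
      unfolding has_real_derivative_iff_has_vector_derivative[symmetric]
    proof -
      have "1 + (\<phi> t / N)\<^sup>2 = ((\<phi> t)\<^sup>2 + N\<^sup>2) / N\<^sup>2"
        using \<open>0 < N\<close> by (simp add: field_simps)
      thus "((\<lambda>t. \<sigma> * arctan (\<phi> t / N) / N) has_real_derivative \<sigma> * \<phi>' t / ((\<phi> t)\<^sup>2 + N\<^sup>2)) (at t within {a..b})"
        using \<open>0 < N\<close>
        by (auto intro!: derivative_eq_intros \<phi> that simp: power2_eq_square)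
    qed
    from has_integral_mult_right[OF fundamental_theorem_of_calculus[OF \<open>a \<le> b\<close> this], of "C1 + C2"]
      has_integral_const_real[of "C3 / N" a b] \<open>a \<le> b\<close>
    show ?thesis unfolding D_def [abs_def] by (auto intro!: has_integral_add)
  qed
  have R_le: "norm (R t) \<le> D t" if t: "t \<in> {a..b}" for t
  proof -
    have s: "\<bar>\<phi>' t\<bar> = \<sigma> * \<phi>' t" using sgn(1) sgn(2)[OF t] by auto
    have nn: "0 \<le> C1" "0 \<le> C3"
      using A_le[OF t] A'_le[OF t] norm_ge_zero order_trans by blast+
    have R: "R t = \<i> * (A t * E t) * of_real (N\<^sup>2 / ((\<phi> t)\<^sup>2 + N\<^sup>2)) - A' t * E t * of_real (q t)
             - A t * E t * of_real (q' t)"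
    proof -
      have "N\<^sup>2 / ((\<phi> t)\<^sup>2 + N\<^sup>2) = 1 - \<phi> t * q t"
        using less_imp_neq[OF pos[of t]] unfolding q_def
        by (simp add: divide_simps) (simp add: power2_eq_square)
      hence w: "complex_of_real (N\<^sup>2 / ((\<phi> t)\<^sup>2 + N\<^sup>2)) = 1 - of_real (\<phi> t * q t)"
        by (simp only: of_real_diff of_real_1)
      show ?thesis unfolding w R_def V'_def by (simp add: algebra_simps)
    qed
    have E1: "x * norm (E t) \<le> x" if "0 \<le> x" for x
      using norm_E[OF t] that by (simp add: mult_left_le)
    have "norm (\<i> * (A t * E t) * of_real (N\<^sup>2 / ((\<phi> t)\<^sup>2 + N\<^sup>2))) = norm (A t) * norm (E t) * (N\<^sup>2 / ((\<phi> t)\<^sup>2 + N\<^sup>2))"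
      using pos[of t] by (simp add: norm_mult norm_divide norm_power flip: of_real_power of_real_add)
    also have "\<dots> \<le> norm (A t) * (N\<^sup>2 / ((\<phi> t)\<^sup>2 + N\<^sup>2))"
      using pos[of t] by (intro mult_right_mono E1) auto
    also have "\<dots> \<le> C2 * (\<sigma> * \<phi>' t / ((\<phi> t)\<^sup>2 + N\<^sup>2))"
      using divide_right_mono[OF A_le_curv[OF t, unfolded s] less_imp_le[OF pos[of t]]]
      by (simp add: mult.commute)
    finally have 1: "norm (\<i> * (A t * E t) * of_real (N\<^sup>2 / ((\<phi> t)\<^sup>2 + N\<^sup>2))) \<le> \<dots>" .
    have "\<bar>q t\<bar> \<le> 1 / N"
    proof -
      have "0 \<le> (\<bar>\<phi> t\<bar> - N)\<^sup>2" "0 \<le> \<bar>\<phi> t\<bar> * N" using \<open>0 < N\<close> by simp_all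
      hence "\<bar>\<phi> t\<bar> * N \<le> (\<phi> t)\<^sup>2 + N\<^sup>2"
        unfolding power2_diff power2_abs by linarith
      hence "\<bar>\<phi> t\<bar> / ((\<phi> t)\<^sup>2 + N\<^sup>2) \<le> 1 / N"
        using pos[of t] \<open>0 < N\<close> by (simp add: pos_le_divide_eq pos_divide_le_eq)
      thus ?thesis unfolding q_def abs_divide abs_of_pos[OF pos] .
    qed
    hence "norm (A' t) * norm (E t) * \<bar>q t\<bar> \<le> C3 * 1 * (1 / N)"
      using A'_le[OF t] norm_E[OF t] nn \<open>0 < N\<close> by (intro mult_mono) auto
    hence 2: "norm (A' t * E t * of_real (q t)) \<le> C3 / N"
      by (simp add: norm_mult)
    have "\<bar>q' t\<bar> \<le> \<sigma> * \<phi>' t / ((\<phi> t)\<^sup>2 + N\<^sup>2)"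
    proof -
      have "\<bar>N\<^sup>2 - (\<phi> t)\<^sup>2\<bar> \<le> (\<phi> t)\<^sup>2 + N\<^sup>2"
        using zero_le_power2[of N] zero_le_power2[of "\<phi> t"] unfolding abs_le_iff by linarith
      hence "\<bar>\<phi>' t\<bar> * \<bar>N\<^sup>2 - (\<phi> t)\<^sup>2\<bar> \<le> \<bar>\<phi>' t\<bar> * ((\<phi> t)\<^sup>2 + N\<^sup>2)"
        by (rule mult_left_mono) auto
      hence "\<bar>q' t\<bar> \<le> \<bar>\<phi>' t\<bar> * ((\<phi> t)\<^sup>2 + N\<^sup>2) / ((\<phi> t)\<^sup>2 + N\<^sup>2)\<^sup>2"
        unfolding q'_def by (simp add: abs_mult divide_right_mono)
      thus ?thesis unfolding s using less_imp_neq[OF pos[of t]] \<open>0 < N\<close>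
        by (simp add: power2_eq_square[of "(\<phi> t)\<^sup>2 + N\<^sup>2"])
    qed
    hence "norm (A t) * norm (E t) * \<bar>q' t\<bar> \<le> C1 * 1 * (\<sigma> * \<phi>' t / ((\<phi> t)\<^sup>2 + N\<^sup>2))"
      using A_le[OF t] norm_E[OF t] nn by (intro mult_mono mult_nonneg_nonneg) simp_all
    hence 3: "norm (A t * E t * of_real (q' t)) \<le> C1 * (\<sigma> * \<phi>' t / ((\<phi> t)\<^sup>2 + N\<^sup>2))"
      by (simp add: norm_mult)
    have tri: "norm (X - Y - Z) \<le> (C1 + C2) * w + c"
      if "norm X \<le> C2 * w" "norm Y \<le> c" "norm Z \<le> C1 * w" for X Y Z :: complex and w c
      using norm_triangle_ineq4[of "X - Y" Z] norm_triangle_ineq4[of X Y] that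
      unfolding distrib_right by linarith
    show ?thesis unfolding R D_def by (rule tri[OF 1 2 3])
  qed
  have "norm (integral {a..b} R) \<le> integral {a..b} D"
    by (rule integral_norm_bound_integral) (use int_R int_D R_le in auto)
  hence "norm (integral {a..b} (\<lambda>t. A t * E t)) \<le>
      (C1 + C2) * (\<sigma> * arctan (\<phi> b / N) / N - \<sigma> * arctan (\<phi> a / N) / N) + (b - a) * (C3 / N)"
    using integral_unique[OF int_R] integral_unique[OF int_D] by (simp add: norm_mult)
  also have "\<dots> \<le> (C1 + C2) * (pi / N) + (b - a) * (C3 / N)"
  proof -
    have "0 \<le> C1" using A_le[of a] ends(1) \<open>a \<le> b\<close> by simp
    have "arctan x - arctan y \<le> pi" for x y
      using arctan_bounded[of x] arctan_bounded[of y] by linarith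
    hence "\<sigma> * arctan (\<phi> b / N) - \<sigma> * arctan (\<phi> a / N) \<le> pi"
      using sgn(1) by auto
    hence "\<sigma> * arctan (\<phi> b / N) / N - \<sigma> * arctan (\<phi> a / N) / N \<le> pi / N"
      using \<open>0 < N\<close> by (simp add: divide_right_mono flip: diff_divide_distrib)
    thus ?thesis
      using \<open>0 \<le> C1\<close> \<open>0 \<le> C2\<close> by (intro add_right_mono mult_left_mono) auto
  qed
  also have "\<dots> = (pi * (C1 + C2) + (b - a) * C3) / N"
    by (simp add: add_divide_distrib mult.commute)
  finally show ?thesis .
qed

section \<open>Coordinates as contour integrals\<close>

definition representative :: "real \<Rightarrow> nat \<Rightarrow> complex vec \<Rightarrow> (complex \<Rightarrow> complex) \<Rightarrow> complex \<Rightarrow> complex" where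
  "representative l n x g z =
     (\<Sum>j=1..n. vec_index x (j - 1) * basis_fun l j z) + blaschke l z ^ n * g z"

text \<open>
  Integration against this kernel picks out the j-th coordinate, as a residue at l.
\<close>

definition coordinate_kernel :: "real \<Rightarrow> nat \<Rightarrow> complex \<Rightarrow> complex" where
  "coordinate_kernel l j z = of_real (sqrt (1 - l\<^sup>2)) / ((1 - of_real l * z) * blaschke l z ^ j)"

lemma coordinate_kernel_holomorphic:
  assumes "0 < l" "l < 1"
  shows "coordinate_kernel l j holomorphic_on ball 0 (1 / l) - {of_real l}"
  unfolding coordinate_kernel_def [abs_def] blaschke_def
  using one_minus_mult_nonzero_ball[OF assms(1)]
  by (auto intro!: holomorphic_intros)

text \<open>
  The product is b' * b ^ (i - 1 - j), whose integral counts the exponent -1 only.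
\<close>

lemma basis_fun_times_kernel_integral:
  assumes l: "0 < l" "l < 1" and r: "l < r" "r < 1" and ij: "1 \<le> i" "1 \<le> j"
  shows "((\<lambda>z. basis_fun l i z * coordinate_kernel l j z) has_contour_integral
            (if i = j then 2 * of_real pi * \<i> else 0)) (circlepath 0 r)"
proof -
  have "0 < r" using l r by linarith
  have s: "complex_of_real (sqrt (1 - l\<^sup>2)) * of_real (sqrt (1 - l\<^sup>2)) = 1 - of_real l ^ 2"
    using l by (simp flip: of_real_mult add: power_le_one)
  have on_circle: "norm z < 1" "blaschke l z \<noteq> 0" "1 - of_real l * z \<noteq> 0" "z \<noteq> of_real l"
    if "z \<in> path_image (circlepath 0 r)" for z
    using that l r \<open>0 < r\<close> blaschke_eq_0_iff[OF l, of z] one_minus_mult_nonzero[OF l, of z] by auto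
  have integrand: "basis_fun l i z * coordinate_kernel l j z =
      (1 - of_real l ^ 2) / (1 - of_real l * z)\<^sup>2 * (blaschke l z ^ (i - 1) / blaschke l z ^ j)" for z
    unfolding basis_fun_def coordinate_kernel_def s[symmetric] by (simp add: power2_eq_square mult_ac)
  (* With the left factor of the integrand equal to b', the three cases are: no pole in the disk,
     the logarithmic derivative of b, and an exact derivative. *)
  consider "i > j" | "i = j" | "i < j" by linarith
  thus ?thesis
  proof cases
    case 1
    have "((\<lambda>z. (1 - of_real l ^ 2) / (1 - of_real l * z)\<^sup>2 * blaschke l z ^ (i - 1 - j))
            has_contour_integral 0) (circlepath 0 r)"
    proof (rule Cauchy_theorem_disc_simple[where a = 0 and e = 1])
      show "(\<lambda>z. (1 - of_real l ^ 2) / (1 - of_real l * z)\<^sup>2 * blaschke l z ^ (i - 1 - j)) holomorphic_on ball 0 1"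
        using one_minus_mult_nonzero[OF l] wiener_blaschke[OF l]
        by (auto intro!: holomorphic_intros simp: wiener_algebra_iff)
    qed (use r \<open>0 < r\<close> in auto)
    with 1 show ?thesis
      by (auto simp: integrand power_diff on_circle intro: has_contour_integral_eq)
  next
    case 2
    have "((\<lambda>z. (1 - of_real l ^ 2) / (1 - of_real l * z) / (z - of_real l)) has_contour_integral
            2 * of_real pi * \<i> * ((1 - of_real l ^ 2) / (1 - of_real l * of_real l))) (circlepath 0 r)"
      by (rule Cauchy_integral_circlepath_simple)
         (use l r one_minus_mult_nonzero[OF l] in \<open>auto intro!: holomorphic_intros\<close>)
    moreover have "1 - complex_of_real l * of_real l \<noteq> 0"
      using one_minus_mult_nonzero[OF l, of "of_real l"] l by simp
    ultimately have "((\<lambda>z. (1 - of_real l ^ 2) / (1 - of_real l * z) / (z - of_real l))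
        has_contour_integral 2 * of_real pi * \<i>) (circlepath 0 r)"
      by (simp add: power2_eq_square)
    moreover have "(1 - of_real l ^ 2) / (1 - of_real l * z) / (z - of_real l) =
        basis_fun l i z * coordinate_kernel l j z" if "z \<in> path_image (circlepath 0 r)" for z
    proof -
      have "blaschke l z ^ (j - 1) / blaschke l z ^ j = 1 / blaschke l z"
        using ij on_circle(2)[OF that] by (cases j) auto
      thus ?thesis using 2 on_circle[OF that] unfolding integrand
        by (simp add: blaschke_def power2_eq_square)
    qed
    ultimately show ?thesis using 2 by (auto intro: has_contour_integral_eq)
  next
    case 3
    define p where "p = j - i"
    have p: "p \<ge> 1" "j = (i - 1) + Suc p" using 3 ij by (auto simp: p_def)
    have "((\<lambda>z. (1 - of_real l ^ 2) / (1 - of_real l * z)\<^sup>2 / blaschke l z ^ Suc p)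
            has_contour_integral 0) (circlepath 0 r)"
    proof (rule Cauchy_theorem_primitive[where f = "\<lambda>z. inverse (blaschke l z ^ p) / - of_nat p"
             and S = "path_image (circlepath 0 r)"])
      fix z assume z: "z \<in> path_image (circlepath 0 r)"
      show "((\<lambda>z. inverse (blaschke l z ^ p) / - of_nat p) has_field_derivative
              (1 - of_real l ^ 2) / (1 - of_real l * z)\<^sup>2 / blaschke l z ^ Suc p)
              (at z within path_image (circlepath 0 r))"
      proof -
        obtain m where m: "p = Suc m" using p(1) by (cases p) auto
        have deriv_power: "((\<lambda>z. blaschke l z ^ p) has_field_derivative
            of_nat p * ((1 - of_real l ^ 2) / (1 - of_real l * z)\<^sup>2 * blaschke l z ^ m))
            (at z within path_image (circlepath 0 r))"
          using DERIV_power[OF blaschke_has_field_derivative[OF l order_less_imp_le[OF on_circle(1)[OF z]]], of p]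
          by (simp add: m del: of_nat_Suc)
        have cancel: "- (inverse (w ^ Suc m) * (c * (D * w ^ m)) * inverse (w ^ Suc m)) / - c = D / w ^ Suc (Suc m)"
          if "w \<noteq> 0" "c \<noteq> 0" for w c D :: complex
          using that by (simp add: field_simps)
        have nz: "blaschke l z ^ Suc m \<noteq> 0" "of_nat (Suc m) \<noteq> (0 :: complex)"
          using on_circle(2)[OF z] by (simp_all del: of_nat_Suc)
        show ?thesis
          unfolding m
          by (rule DERIV_cong[OF DERIV_cdivide[OF DERIV_inverse'[OF deriv_power[unfolded m] nz(1)]]])
             (rule cancel[OF on_circle(2)[OF z] nz(2)])
      qed
    qed auto
    moreover have "(1 - of_real l ^ 2) / (1 - of_real l * z)\<^sup>2 / blaschke l z ^ Suc p =
        basis_fun l i z * coordinate_kernel l j z" if "z \<in> path_image (circlepath 0 r)" for z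
    proof -
      have "blaschke l z ^ (i - 1) / blaschke l z ^ j = 1 / blaschke l z ^ Suc p"
        using on_circle(2)[OF that] by (subst p(2), subst power_add) simp
      thus ?thesis unfolding integrand by simp
    qed
    ultimately show ?thesis using 3 by (auto intro: has_contour_integral_eq)
  qed
qed

text \<open>
  The multiple of b ^ n does not contribute, since j does not exceed n and the kernel has a pole of order j.
  Hence the integral is the same for all representatives of a class, and it may be used to bound
  the quotient norm from below.
\<close>

lemma coordinate_integral:
  assumes l: "0 < l" "l < 1" and r: "l < r" "r < 1" and j: "1 \<le> j" "j \<le> n"
    and g: "g \<in> wiener_algebra"
  shows "((\<lambda>z. representative l n x g z * coordinate_kernel l j z) has_contour_integral
            2 * of_real pi * \<i> * vec_index x (j - 1)) (circlepath 0 r)"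
proof -
  have "0 < r" using l r by linarith
  have basis: "((\<lambda>z. \<Sum>i=1..n. vec_index x (i - 1) * (basis_fun l i z * coordinate_kernel l j z))
      has_contour_integral (\<Sum>i=1..n. vec_index x (i - 1) * (if i = j then 2 * of_real pi * \<i> else 0)))
      (circlepath 0 r)"
    by (intro has_contour_integral_sum has_contour_integral_lmul basis_fun_times_kernel_integral)
       (use l r j in auto)
  also have "(\<Sum>i=1..n. vec_index x (i - 1) * (if i = j then 2 * of_real pi * \<i> else 0)) =
      2 * of_real pi * \<i> * vec_index x (j - 1)"
    using j by (simp add: if_distrib[of "(*) _"] sum.delta mult_ac cong: if_cong)
  finally have basis: "((\<lambda>z. \<Sum>i=1..n. vec_index x (i - 1) * (basis_fun l i z * coordinate_kernel l j z))
      has_contour_integral 2 * of_real pi * \<i> * vec_index x (j - 1)) (circlepath 0 r)" .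
  have remainder: "((\<lambda>z. of_real (sqrt (1 - l\<^sup>2)) / (1 - of_real l * z) * blaschke l z ^ (n - j) * g z)
            has_contour_integral 0) (circlepath 0 r)"
  proof (rule Cauchy_theorem_disc_simple[where a = 0 and e = 1])
    show "(\<lambda>z. of_real (sqrt (1 - l\<^sup>2)) / (1 - of_real l * z) * blaschke l z ^ (n - j) * g z) holomorphic_on ball 0 1"
      using one_minus_mult_nonzero[OF l] wiener_blaschke[OF l] g
      by (auto intro!: holomorphic_intros simp: wiener_algebra_iff)
  qed (use r \<open>0 < r\<close> in auto)
  have "((\<lambda>z. (\<Sum>i=1..n. vec_index x (i - 1) * (basis_fun l i z * coordinate_kernel l j z)) +
       of_real (sqrt (1 - l\<^sup>2)) / (1 - of_real l * z) * blaschke l z ^ (n - j) * g z)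
       has_contour_integral 2 * of_real pi * \<i> * vec_index x (j - 1)) (circlepath 0 r)"
    using has_contour_integral_add[OF basis remainder] by simp
  thus ?thesis
  proof (rule has_contour_integral_eq)
    fix z assume "z \<in> path_image (circlepath 0 r)"
    hence "blaschke l z \<noteq> 0" using l r \<open>0 < r\<close> blaschke_eq_0_iff[OF l, of z] by auto
    hence "of_real (sqrt (1 - l\<^sup>2)) / (1 - of_real l * z) * blaschke l z ^ (n - j) * g z =
        blaschke l z ^ n * g z * coordinate_kernel l j z"
      using j(2) by (simp add: coordinate_kernel_def power_diff)
    moreover have "(\<Sum>i=1..n. vec_index x (i - 1) * (basis_fun l i z * coordinate_kernel l j z)) =
        (\<Sum>i=1..n. vec_index x (i - 1) * basis_fun l i z) * coordinate_kernel l j z"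
      by (simp add: sum_distrib_right mult.assoc)
    ultimately show "(\<Sum>i=1..n. vec_index x (i - 1) * (basis_fun l i z * coordinate_kernel l j z)) +
       of_real (sqrt (1 - l\<^sup>2)) / (1 - of_real l * z) * blaschke l z ^ (n - j) * g z =
       representative l n x g z * coordinate_kernel l j z"
      by (simp only: representative_def distrib_right)
  qed
qed

text \<open>
  A functional given by integration against K is determined by the values it takes on the monomials;
  a uniform bound for these moments is a bound for its norm on the Wiener algebra, by absolute
  summability of the coefficients.
\<close>

lemma contour_pairing_bound:
  assumes l: "0 < l" "l < 1" and r: "l < r" "r < 1"
    and K: "K holomorphic_on ball 0 (1 / l) - {of_real l}"
    and f: "f \<in> wiener_algebra"
    and M: "\<And>k. norm (contour_integral (circlepath 0 1) (\<lambda>z. z ^ k * K z)) \<le> M"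
  shows "norm (contour_integral (circlepath 0 r) (\<lambda>z. f z * K z)) \<le> M * wiener_norm f"
proof -
  define S where "S = ball (0::complex) (1 / l) - {of_real l}"
  define a where "a = wiener_coeff f"
  have a: "summable (\<lambda>k. norm (a k))" "\<And>z. z \<in> ball 0 1 \<Longrightarrow> (\<lambda>k. a k * z ^ k) sums f z"
    using f by (auto simp: wiener_algebra_def a_def)
  have "0 < r" using l r by linarith
  have "1 < 1 / l" using l by (simp add: field_simps)
  have sphere_S: "sphere 0 r \<subseteq> S"
    using r l less_trans[OF r(2) \<open>1 < 1 / l\<close>] by (auto simp: S_def)
  have contK: "continuous_on (sphere 0 r) K"
    using holomorphic_on_imp_continuous_on[OF K] continuous_on_subset sphere_S
    unfolding S_def by blast
  (* The power series is only summed inside the disk; the monomials, however, may be moved to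
     the unit circle one at a time, because the kernel is singular only at l and beyond 1 / l. *)
  have moment: "contour_integral (circlepath 0 r) (\<lambda>z. z ^ k * K z) =
        contour_integral (circlepath 0 1) (\<lambda>z. z ^ k * K z)" for k
  proof (rule Cauchy_theorem_homotopic_loops)
    show "homotopic_loops S (circlepath 0 r) (circlepath 0 1)"
    proof (rule homotopic_loops_linear)
      fix t :: real
      define u where "u = exp (2 * of_real pi * \<i> * of_real t)"
      have u: "norm u = 1" unfolding u_def by (simp add: norm_exp_eq_Re)
      show "closed_segment (circlepath 0 r t) (circlepath 0 1 t) \<subseteq> S"
      proof
        fix z assume "z \<in> closed_segment (circlepath 0 r t) (circlepath 0 1 t)"
        then obtain v where v: "0 \<le> v" "v \<le> 1" "z = (1 - v) *\<^sub>R (of_real r * u) + v *\<^sub>R u"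
          by (auto simp: closed_segment_def circlepath u_def)
        hence "z = of_real ((1 - v) * r + v) * u"
          by (simp add: scaleR_conv_of_real algebra_simps)
        hence "norm z = \<bar>(1 - v) * r + v\<bar>" by (simp only: norm_mult norm_of_real u mult_1_right)
        also have "\<dots> = (1 - v) * r + v"
          using v \<open>0 < r\<close> by (intro abs_of_nonneg add_nonneg_nonneg mult_nonneg_nonneg) auto
        also have "\<dots> = r + v * (1 - r)" by (simp add: algebra_simps)
        finally have nz: "norm z = r + v * (1 - r)" .
        have "v * (1 - r) \<le> 1 - r" "0 \<le> v * (1 - r)"
          using mult_right_mono[OF v(2), of "1 - r"] v r by simp_all
        hence "norm z \<le> 1" "r \<le> norm z" unfolding nz by linarith+
        hence "l < norm z" "norm z < 1 / l" using \<open>1 < 1 / l\<close> r by linarith+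
        thus "z \<in> S" using l by (auto simp: S_def)
      qed
    qed auto
    show "(\<lambda>z. z ^ k * K z) holomorphic_on S"
      using K unfolding S_def by (intro holomorphic_intros)
  qed (auto simp: S_def)
  have "\<exists>KB. \<forall>z\<in>sphere 0 r. norm (K z) \<le> KB"
    using compact_imp_bounded[OF compact_continuous_image[OF contK compact_sphere]]
    unfolding bounded_iff by simp
  then obtain KB where KB: "\<And>z. z \<in> sphere 0 r \<Longrightarrow> norm (K z) \<le> KB" by blast
  have "uniform_limit (sphere 0 r) (\<lambda>n z. \<Sum>k<n. a k * (z ^ k * K z))
          (\<lambda>z. \<Sum>k. a k * (z ^ k * K z)) sequentially"
  proof (rule Weierstrass_m_test)
    show "summable (\<lambda>k. norm (a k) * KB)" by (rule summable_mult2[OF a(1)])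
    fix k and z :: complex assume z: "z \<in> sphere 0 r"
    have "norm z ^ k * norm (K z) \<le> 1 * KB"
      using z r \<open>0 < r\<close> by (intro mult_mono KB power_le_one) auto
    thus "norm (a k * (z ^ k * K z)) \<le> norm (a k) * KB"
      by (auto simp: norm_mult norm_power intro!: mult_left_mono)
  qed
  also have "?this \<longleftrightarrow> uniform_limit (sphere 0 r) (\<lambda>n z. \<Sum>k<n. a k * (z ^ k * K z)) (\<lambda>z. f z * K z) sequentially"
  proof (rule uniform_limit_cong')
    fix z :: complex assume "z \<in> sphere 0 r"
    hence "z \<in> ball 0 1" using r by simp
    from sums_mult2[OF a(2)[OF this], of "K z"] show "(\<Sum>k. a k * (z ^ k * K z)) = f z * K z"
      by (simp add: sums_iff mult.assoc)
  qed simp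
  finally have ul: "uniform_limit (sphere 0 r) (\<lambda>n z. \<Sum>k<n. a k * (z ^ k * K z)) (\<lambda>z. f z * K z) sequentially" .
  have integrable: "(\<lambda>z. z ^ k * K z) contour_integrable_on circlepath 0 r" for k
    using contK \<open>0 < r\<close>
    by (intro contour_integrable_continuous_circlepath continuous_intros) auto
  have sum_eq: "contour_integral (circlepath 0 r) (\<lambda>z. \<Sum>k<n. a k * (z ^ k * K z)) =
        (\<Sum>k<n. a k * contour_integral (circlepath 0 1) (\<lambda>z. z ^ k * K z))" for n
    by (simp add: contour_integral_sum contour_integral_lmul contour_integrable_lmul integrable moment)
  have lim: "(\<lambda>n. \<Sum>k<n. a k * contour_integral (circlepath 0 1) (\<lambda>z. z ^ k * K z))
           \<longlonglongrightarrow> contour_integral (circlepath 0 r) (\<lambda>z. f z * K z)"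
    unfolding sum_eq[symmetric]
    by (intro contour_integral_uniform_limit_circlepath(2)[OF _ ul] always_eventually allI
          contour_integrable_sum contour_integrable_lmul integrable) (use \<open>0 < r\<close> in auto)
  have "0 \<le> M" using M[of 0] norm_ge_zero order_trans by blast
  have "norm (\<Sum>k<n. a k * contour_integral (circlepath 0 1) (\<lambda>z. z ^ k * K z)) \<le> M * wiener_norm f" for n
  proof -
    have "norm (\<Sum>k<n. a k * contour_integral (circlepath 0 1) (\<lambda>z. z ^ k * K z)) \<le> (\<Sum>k<n. norm (a k) * M)"
      by (rule sum_norm_le) (auto simp: norm_mult intro!: mult_left_mono M)
    also have "\<dots> = M * (\<Sum>k<n. norm (a k))" by (simp add: sum_distrib_left mult.commute)
    also have "\<dots> \<le> M * wiener_norm f"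
      unfolding wiener_norm_def a_def[symmetric]
      by (intro mult_left_mono sum_le_suminf \<open>0 \<le> M\<close> a(1)) auto
    finally show ?thesis .
  qed
  thus ?thesis by (intro tendsto_upperbound[OF tendsto_norm[OF lim]]) auto
qed

section \<open>Moments of the difference of two coordinate kernels\<close>

text \<open>
  This is the denominator of the Poisson kernel.
\<close>

lemma norm_one_minus_mult_cis_square:
  "(norm (1 - of_real l * cis t))\<^sup>2 = 1 - 2 * l * cos t + l\<^sup>2"
proof -
  have "(norm (1 - of_real l * cis t))\<^sup>2 = (1 - l * cos t)\<^sup>2 + (l * sin t)\<^sup>2"
    unfolding cmod_power2 by simp
  also have "(l * sin t)\<^sup>2 = l\<^sup>2 * (1 - (cos t)\<^sup>2)"
    by (simp add: power_mult_distrib sin_squared_eq)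
  also have "(1 - l * cos t)\<^sup>2 + l\<^sup>2 * (1 - (cos t)\<^sup>2) = 1 - 2 * l * cos t + l\<^sup>2"
    by (simp add: power2_eq_square algebra_simps)
  finally show ?thesis .
qed

lemma poisson_denominator_pos:
  fixes l t :: real
  assumes "0 < l" "l < 1"
  shows "0 < 1 - 2 * l * cos t + l\<^sup>2"
  unfolding norm_one_minus_mult_cis_square[symmetric]
  using one_minus_mult_nonzero[OF assms, of "cis t"] by simp

text \<open>
  On the unit circle z ^ k / b(z) ^ n has modulus 1, and its phase has derivative k - n P(t), where P is
  the Poisson kernel at l, because z b'(z) / b(z) = P(t) for z = cis t.
\<close>

lemma blaschke_monomial_phase:
  assumes l: "0 < l" "l < 1"
  shows "((\<lambda>t. cis t ^ k * ((1 - of_real l * cis t) / (cis t - of_real l)) ^ n) has_vector_derivative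
     \<i> * of_real (real k - real n * ((1 - l\<^sup>2) / (1 - 2 * l * cos t + l\<^sup>2))) *
     (cis t ^ k * ((1 - of_real l * cis t) / (cis t - of_real l)) ^ n)) (at t within S)"
proof -
  define z where "z = cis t"
  define w where "w = (1 - of_real l * z) / (z - of_real l)"
  define \<Delta> where "\<Delta> = 1 - 2 * l * cos t + l\<^sup>2"
  have "norm z = 1" by (simp add: z_def)
  hence z: "z - of_real l \<noteq> 0" "1 - of_real l * z \<noteq> 0" "z \<noteq> 0"
    using l one_minus_mult_nonzero[OF l, of z] by auto
  have "\<Delta> \<noteq> 0" using poisson_denominator_pos[OF l, of t] by (simp add: \<Delta>_def)
  hence "complex_of_real \<Delta> \<noteq> 0" by simp
  have double: "z * z + 1 = 2 * of_real (cos t) * z"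
    using sin_cos_squared_add[of t] by (simp add: z_def complex_eq_iff power2_eq_square)
  have "(z - of_real l) * (1 - of_real l * z) = z + of_real l * of_real l * z - of_real l * (z * z + 1)"
    by (simp add: algebra_simps)
  also have "\<dots> = z * of_real \<Delta>"
    unfolding double \<Delta>_def by (simp add: algebra_simps power2_eq_square)
  finally have \<Delta>: "(z - of_real l) * (1 - of_real l * z) = z * of_real \<Delta>" .
  define Q where "Q = (1 - of_real l ^ 2) / complex_of_real \<Delta>"
  define D where "D = - (1 - of_real l ^ 2) / (z - of_real l) ^ 2"
  have dw: "((\<lambda>z. (1 - of_real l * z) / (z - of_real l)) has_field_derivative
       D) (at z)"
    unfolding D_def using z by (auto intro!: derivative_eq_intros simp: power2_eq_square algebra_simps)
  have zdw: "z * D = - w * Q"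
  proof -
    have "z / (z - of_real l) = (1 - of_real l * z) / of_real \<Delta>"
      using z \<Delta> \<open>complex_of_real \<Delta> \<noteq> 0\<close> by (simp add: frac_eq_eq mult_ac)
    hence "z / (z - of_real l) / (z - of_real l) = w / of_real \<Delta>" by (simp add: w_def)
    moreover have "z * D =
        - (1 - of_real l ^ 2) * (z / (z - of_real l) / (z - of_real l))"
      by (simp add: D_def power2_eq_square[of "z - of_real l"])
    moreover have "- D * (w / d) = - w * (D / d)" for D d by simp
    ultimately show ?thesis by (simp only: Q_def)
  qed
  have zk: "z * (of_nat k * z ^ (k - 1)) = of_nat k * z ^ k" by (cases k) auto
  have wn: "of_nat n * w ^ (n - 1) * w = of_nat n * w ^ n" by (cases n) auto
  have "((\<lambda>z. z ^ k * ((1 - of_real l * z) / (z - of_real l)) ^ n) has_field_derivative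
      of_nat k * z ^ (k - 1) * w ^ n
      + z ^ k * (of_nat n * w ^ (n - 1) * D)) (at z)"
    by (rule DERIV_cong[OF DERIV_mult[OF DERIV_power[OF DERIV_ident, where n = k] DERIV_power[OF dw, where n = n]]])
       (simp add: w_def mult_ac)
  moreover have "(cis has_vector_derivative \<i> * z) (at t)"
    unfolding has_vector_derivative_def z_def by (auto intro!: derivative_eq_intros)
  ultimately have "((\<lambda>t. cis t ^ k * ((1 - of_real l * cis t) / (cis t - of_real l)) ^ n) has_vector_derivative
      \<i> * z * (of_nat k * z ^ (k - 1) * w ^ n
      + z ^ k * (of_nat n * w ^ (n - 1) * D))) (at t)"
    unfolding z_def using field_vector_diff_chain_at[of cis _ t] by (simp add: o_def)
  also have "\<i> * z * (of_nat k * z ^ (k - 1) * w ^ n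
      + z ^ k * (of_nat n * w ^ (n - 1) * D))
      = \<i> * ((z * (of_nat k * z ^ (k - 1))) * w ^ n
      + z ^ k * (of_nat n * w ^ (n - 1)) * (z * D))"
    by (simp only: distrib_left mult_ac)
  also have "\<dots> = \<i> * (of_nat k * z ^ k * w ^ n - z ^ k * (of_nat n * w ^ (n - 1) * w) * Q)"
  proof -
    have "\<i> * (X + Y * P * (- w * Q)) = \<i> * (X - Y * (P * w) * Q)" for X Y P
      by (simp add: algebra_simps)
    thus ?thesis unfolding zk zdw by blast
  qed
  also have "\<dots> = \<i> * (of_nat k - of_nat n * Q) * (z ^ k * w ^ n)"
    unfolding wn by (simp add: algebra_simps)
  also have "of_nat k - of_nat n * Q = of_real (real k - real n * ((1 - l\<^sup>2) / \<Delta>))"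
    by (simp add: Q_def)
  finally show ?thesis
    unfolding z_def w_def \<Delta>_def by (rule has_vector_derivative_at_within)
qed

text \<open>
  Each moment of a single kernel is an oscillatory integral whose phase has derivative k - n P(t). At
  t = 0 and t = \<pi> the derivative of P vanishes, and for k close to n P(0) or n P(\<pi>) the integral is
  then only of order n powr (-1/3). The difference of two kernels carries the extra factor 1 - b(z) ^ 2,
  which vanishes at z = 1 and z = -1, and this restores the order n powr (-1/2) uniformly in k.
\<close>

lemma second_difference_moments:
  assumes l: "0 < l" "l < 1"
  shows "\<exists>C>0. \<forall>n\<ge>2. \<forall>k. norm (contour_integral (circlepath 0 1)
           (\<lambda>z. z ^ k * (coordinate_kernel l n z - coordinate_kernel l (n - 2) z))) \<le> C / sqrt (real n)"
proof -
  define s where "s = sqrt (1 - l\<^sup>2)"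
  have s: "0 < s" "s \<le> 1" using l by (auto simp: s_def power_less_one_iff)
  (* On the circle the integrand, with dz = i z dt, is a(z) times z ^ k / b(z) ^ n. *)
  define a where "a z = \<i> * of_real s * (1 - of_real l ^ 2) * z * (1 - z ^ 2) / (1 - of_real l * z) ^ 3" for z :: complex
  have hol: "a holomorphic_on ball 0 (1 / l)"
    unfolding a_def [abs_def] using one_minus_mult_nonzero_ball[OF l(1)]
    by (auto intro!: holomorphic_intros)
  have "1 < 1 / l" using l by (simp add: field_simps)
  hence sub: "sphere (0::complex) 1 \<subseteq> ball 0 (1 / l)" by auto
  have bdd: "\<exists>B. \<forall>z\<in>sphere 0 1. norm (f z) \<le> B" if "f holomorphic_on ball 0 (1 / l)" for f :: "complex \<Rightarrow> complex"
    using compact_imp_bounded[OF compact_continuous_image[OF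
        continuous_on_subset[OF holomorphic_on_imp_continuous_on[OF that] sub] compact_sphere]]
    unfolding bounded_iff by simp
  obtain C1 where "\<forall>z\<in>sphere 0 1. norm (a z) \<le> C1"
    using bdd[OF hol] by blast
  hence C1: "norm (a z) \<le> C1" if "norm z = 1" for z
    using that by simp
  obtain C3 where "\<forall>z\<in>sphere 0 1. norm (deriv a z) \<le> C3"
    using bdd[OF holomorphic_deriv[OF hol]] by blast
  hence C3: "norm (deriv a z) \<le> C3" if "norm z = 1" for z
    using that by simp
  define C where "C = 2 * (pi * (C1 + 2 / l) + pi * C3)"
  have "0 \<le> C1" "0 \<le> C3"
    using order_trans[OF norm_ge_zero C1[of 1]] order_trans[OF norm_ge_zero C3[of 1]] by simp_all
  moreover have "0 < C1 + 2 / l" using \<open>0 \<le> C1\<close> l by (simp add: add_nonneg_pos)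
  ultimately have "0 < pi * (C1 + 2 / l)" "0 \<le> pi * C3"
    by (simp_all only: mult_pos_pos pi_gt_zero mult_nonneg_nonneg pi_ge_zero)
  from add_pos_nonneg[OF this] have "0 < C"
    unfolding C_def by (rule mult_pos_pos[OF zero_less_numeral])
  moreover have "norm (contour_integral (circlepath 0 1)
      (\<lambda>z. z ^ k * (coordinate_kernel l n z - coordinate_kernel l (n - 2) z))) \<le> C / sqrt (real n)"
    if n: "n \<ge> 2" for n k
  proof -
    define A where "A t = a (cis t)" for t
    define E where "E t = cis t ^ k * ((1 - of_real l * cis t) / (cis t - of_real l)) ^ n" for t
    define \<Delta> where "\<Delta> t = 1 - 2 * l * cos t + l\<^sup>2" for t
    define \<phi> where "\<phi> t = real k - real n * ((1 - l\<^sup>2) / \<Delta> t)" for t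
    define \<phi>' where "\<phi>' t = real n * ((1 - l\<^sup>2) * (2 * l * sin t) / (\<Delta> t)\<^sup>2)" for t
    have \<Delta>_pos: "0 < \<Delta> t" for t unfolding \<Delta>_def by (rule poisson_denominator_pos[OF l])
    have nz: "1 - of_real l * cis t \<noteq> 0" "cis t - of_real l \<noteq> 0" for t
    proof -
      show "1 - of_real l * cis t \<noteq> 0" by (rule one_minus_mult_nonzero[OF l]) simp
      have "norm (cis t) \<noteq> norm (complex_of_real l)" using l by simp
      thus "cis t - of_real l \<noteq> 0" by (metis eq_iff_diff_eq_0)
    qed
    define f where "f z = z ^ k * (coordinate_kernel l n z - coordinate_kernel l (n - 2) z)" for z
    have integrand: "f (0 + of_real 1 * cis t) * of_real 1 * \<i> * cis t = A t * E t" for t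
    proof -
      define z where "z = cis t"
      define u where "u = 1 - of_real l * z"
      define v where "v = u / (z - of_real l)"
      have b: "blaschke l z \<noteq> 0" using blaschke_eq_0_iff[OF l, of z] nz(2)[of t] by (auto simp: z_def)
      have "1 / w ^ n - 1 / w ^ (n - 2) = (1 - w ^ 2) * (1 / w ^ n)" if "w \<noteq> 0" for w :: complex
      proof -
        obtain m where "n = Suc (Suc m)" using n by (metis add_2_eq_Suc le_Suc_ex)
        thus ?thesis using that by (simp add: field_simps power2_eq_square)
      qed
      hence diff: "1 / blaschke l z ^ n - 1 / blaschke l z ^ (n - 2) = (1 - blaschke l z ^ 2) * (1 / blaschke l z ^ n)"
        using b by blast
      have v: "1 / blaschke l z ^ n = v ^ n"
        by (simp add: v_def u_def blaschke_def power_divide)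
      have sq: "1 - blaschke l z ^ 2 = (1 - of_real l ^ 2) * (1 - z ^ 2) / u ^ 2"
        unfolding u_def using one_minus_blaschke_square[OF nz(1)[of t]] by (simp only: z_def)
      have kernel: "coordinate_kernel l j z = of_real s / u * (1 / blaschke l z ^ j)" for j
        by (simp add: coordinate_kernel_def s_def u_def)
      have "f z = z ^ k * (of_real s / u * ((1 - of_real l ^ 2) * (1 - z ^ 2) / u ^ 2 * v ^ n))"
        by (simp only: f_def kernel right_diff_distrib[symmetric] diff) (simp only: v sq)
      hence "f z * \<i> * z = \<i> * of_real s * (1 - of_real l ^ 2) * z * (1 - z ^ 2) / u ^ 3 * (z ^ k * v ^ n)"
        by (simp add: power3_eq_cube power2_eq_square[of u] mult_ac)
      thus ?thesis by (simp add: A_def E_def a_def z_def u_def v_def)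
    qed
    have E: "(E has_vector_derivative \<i> * of_real (\<phi> t) * E t) (at t within S)" for t S
      unfolding E_def [abs_def] \<phi>_def \<Delta>_def by (rule blaschke_monomial_phase[OF l])
    have norm_E: "norm (E t) \<le> 1" for t
    proof -
      have "norm ((1 - of_real l * cis t) / (cis t - of_real l)) = 1"
        using norm_blaschke_on_circle[OF l, of "cis t"] nz[of t] by (simp add: blaschke_def norm_divide)
      thus ?thesis by (simp add: E_def norm_mult norm_power)
    qed
    have A: "(A has_vector_derivative \<i> * cis t * deriv a (cis t)) (at t within S)" for t S
    proof -
      have "(cis has_vector_derivative \<i> * cis t) (at t)"
        unfolding has_vector_derivative_def by (auto intro!: derivative_eq_intros)
      moreover have "(a has_field_derivative deriv a (cis t)) (at (cis t))"
        using \<open>1 < 1 / l\<close> by (intro holomorphic_derivI[OF hol]) auto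
      ultimately show ?thesis
        unfolding A_def [abs_def] using field_vector_diff_chain_at[of cis _ t a]
        by (auto simp: o_def intro: has_vector_derivative_at_within)
    qed
    have \<phi>: "(\<phi> has_real_derivative \<phi>' t) (at t within S)" for t S
    proof -
      have "(\<Delta> has_real_derivative 2 * l * sin t) (at t within S)"
        unfolding \<Delta>_def [abs_def] by (auto intro!: derivative_eq_intros)
      from DERIV_diff[OF DERIV_const DERIV_cmult[OF DERIV_divide[OF DERIV_const this less_imp_neq[OF \<Delta>_pos, symmetric]]],
          of "real k" "real n" "1 - l\<^sup>2"]
      show ?thesis unfolding \<phi>_def [abs_def] \<phi>'_def by (simp add: power2_eq_square[of "\<Delta> t"])
    qed
    have A_zero: "A 0 = 0" "A pi = 0" "A (2 * pi) = 0"
      by (simp_all add: A_def a_def)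
    (* Both A and \<phi>' have a simple zero at t = 0 and t = \<pi>; this comparability with the second
       derivative of the phase is what keeps the flat points from costing more than n powr (-1/2). *)
    have A_curv: "(sqrt (real n))\<^sup>2 * norm (A t) \<le> 2 / l * \<bar>\<phi>' t\<bar>" for t
    proof -
      define m where "m = norm (1 - of_real l * cis t)"
      have m: "0 < m" "m \<le> 2" "\<Delta> t = m\<^sup>2"
      proof -
        show "0 < m" using nz(1) by (simp add: m_def)
        have "m \<le> norm (1::complex) + norm (of_real l * cis t)" unfolding m_def by (rule norm_triangle_ineq4)
        thus "m \<le> 2" using l by (simp add: norm_mult)
        show "\<Delta> t = m\<^sup>2" by (simp only: \<Delta>_def m_def norm_one_minus_mult_cis_square)
      qed
      have "1 - cis t ^ 2 = - (2 * \<i> * of_real (sin t) * cis t)"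
        using sin_cos_squared_add[of t] by (simp add: complex_eq_iff power2_eq_square)
      hence n1: "norm (1 - cis t ^ 2) = 2 * \<bar>sin t\<bar>" by (simp add: norm_mult)
      have n2: "norm (1 - complex_of_real l ^ 2) = 1 - l\<^sup>2"
      proof -
        have "1 - complex_of_real l ^ 2 = complex_of_real (1 - l\<^sup>2)" by simp
        hence "norm (1 - complex_of_real l ^ 2) = \<bar>1 - l\<^sup>2\<bar>" by (simp only: norm_of_real)
        thus ?thesis using l by (simp add: power_le_one)
      qed
      have "norm (A t) = s * (1 - l\<^sup>2) * (2 * \<bar>sin t\<bar>) / m ^ 3"
        unfolding A_def a_def using s(1)
        by (simp only: norm_mult norm_divide norm_power n1 n2 m_def) simp
      also have "\<dots> = (s * m) * ((1 - l\<^sup>2) * (2 * \<bar>sin t\<bar>) / m ^ 4)"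
      proof -
        have "m ^ 4 = m * m ^ 3" by (simp add: eval_nat_numeral)
        thus ?thesis using m(1) by simp
      qed
      also have "\<dots> \<le> 2 * ((1 - l\<^sup>2) * (2 * \<bar>sin t\<bar>) / m ^ 4)"
        using mult_mono[OF s(2) m(2)] m(1) l
        by (intro mult_right_mono) (auto simp: power_le_one)
      finally have "real n * norm (A t) \<le> real n * (2 * ((1 - l\<^sup>2) * (2 * \<bar>sin t\<bar>) / m ^ 4))"
        by (rule mult_left_mono) simp
      also have "\<dots> = 2 / l * \<bar>\<phi>' t\<bar>"
      proof -
        have "\<bar>\<phi>' t\<bar> = real n * ((1 - l\<^sup>2) * (2 * l * \<bar>sin t\<bar>) / m ^ 4)"
          unfolding \<phi>'_def m(3) using l by (simp add: abs_mult abs_divide power_le_one flip: power_mult)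
        thus ?thesis using l by simp
      qed
      finally show ?thesis by simp
    qed
    have half: "norm (integral {u..u + pi} (\<lambda>t. A t * E t)) \<le> (pi * (C1 + 2 / l) + pi * C3) / sqrt (real n)"
      if "A u = 0" "A (u + pi) = 0" "\<sigma> \<in> {1, -1}" "\<And>t. t \<in> {u..u + pi} \<Longrightarrow> 0 \<le> \<sigma> * sin t" for u \<sigma>
    proof -
      have sgn: "0 \<le> \<sigma> * \<phi>' t" if t: "t \<in> {u..u + pi}" for t
      proof -
        have "0 \<le> \<sigma> * sin t" using t by fact
        moreover have "0 \<le> real n * (1 - l\<^sup>2) * 2 * l / (\<Delta> t)\<^sup>2" using l by (simp add: power_le_one)
        ultimately have "0 \<le> real n * (1 - l\<^sup>2) * 2 * l / (\<Delta> t)\<^sup>2 * (\<sigma> * sin t)"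
          by (simp only: mult_nonneg_nonneg)
        thus ?thesis by (simp add: \<phi>'_def mult_ac)
      qed
      have A_le: "norm (A t) \<le> C1" for t unfolding A_def by (rule C1) simp
      have A'_le: "norm (\<i> * cis t * deriv a (cis t)) \<le> C3" for t
        using C3[of "cis t"] by (simp add: norm_mult)
      have "norm (integral {u..u + pi} (\<lambda>t. A t * E t)) \<le> (pi * (C1 + 2 / l) + (u + pi - u) * C3) / sqrt (real n)"
        by (rule oscillatory_integral_bound[OF _ _ _ E norm_E A \<phi> that(3) sgn that(1,2) A_le A_curv A'_le])
           (use n l in auto)
      thus ?thesis by simp
    qed
    have "0 \<le> 1 * sin t" if "t \<in> {0..0 + pi}" for t
      using that sin_ge_zero[of t] by simp
    from half[where u = 0 and \<sigma> = 1, OF _ _ _ this] A_zero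
    have h1: "norm (integral {0..pi} (\<lambda>t. A t * E t)) \<le> (pi * (C1 + 2 / l) + pi * C3) / sqrt (real n)"
      by simp
    have two_pi: "2 * pi = pi + pi" by simp
    have "0 \<le> - 1 * sin t" if "t \<in> {pi..pi + pi}" for t
      using that sin_ge_zero[of "t - pi"] by (simp add: sin_diff)
    from half[where u = pi and \<sigma> = "- 1", OF _ _ _ this] A_zero
    have h2: "norm (integral {pi..2 * pi} (\<lambda>t. A t * E t)) \<le> (pi * (C1 + 2 / l) + pi * C3) / sqrt (real n)"
      unfolding two_pi by simp
    have cont: "continuous_on UNIV (\<lambda>t. A t * E t)"
      by (intro continuous_on_mult continuous_on_vector_derivative) (use A E in blast)+
    have integrable: "(\<lambda>t. A t * E t) integrable_on {u..v}" for u v :: real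
      by (intro integrable_continuous_interval continuous_on_subset[OF cont]) simp
    have "((\<lambda>t. f (0 + of_real 1 * cis t) * of_real 1 * \<i> * cis t) has_integral
        integral {0..2 * pi} (\<lambda>t. A t * E t)) {0..2 * pi}"
      unfolding integrand by (rule integrable_integral[OF integrable])
    hence "(f has_contour_integral integral {0..2 * pi} (\<lambda>t. A t * E t)) (circlepath 0 1)"
      unfolding circlepath_def by (subst has_contour_integral_part_circlepath_iff) simp_all
    hence "contour_integral (circlepath 0 1) f = integral {0..2 * pi} (\<lambda>t. A t * E t)"
      by (rule contour_integral_unique)
    also have "\<dots> = integral {0..pi} (\<lambda>t. A t * E t) + integral {pi..2 * pi} (\<lambda>t. A t * E t)"
      by (rule Henstock_Kurzweil_Integration.integral_combine[symmetric]) (simp_all add: integrable)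
    finally have "norm (contour_integral (circlepath 0 1) f) \<le>
        (pi * (C1 + 2 / l) + pi * C3) / sqrt (real n) + (pi * (C1 + 2 / l) + pi * C3) / sqrt (real n)"
      using order_trans[OF norm_triangle_ineq add_mono[OF h1 h2]] by (simp only:)
    also have "\<dots> = C / sqrt (real n)" by (simp only: C_def mult_2 add_divide_distrib)
    finally show ?thesis unfolding f_def [abs_def] .
  qed
  ultimately show ?thesis by blast
qed

section \<open>Lower bounds for the quotient norm\<close>

lemma representative_in_wiener:
  assumes "0 < l" "l < 1" "g \<in> wiener_algebra"
  shows "representative l n x g \<in> wiener_algebra"
  unfolding representative_def [abs_def]
  by (intro wiener_add wiener_sum wiener_mult wiener_const wiener_power wiener_basis_fun wiener_blaschke assms)

lemma quotient_norm_eq: "quotient_norm l n x = (INF g\<in>wiener_algebra. wiener_norm (representative l n x g))"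
  by (simp add: quotient_norm_def representative_def [abs_def])

lemma quotient_norm_le:
  assumes "0 < l" "l < 1" "g \<in> wiener_algebra"
  shows "quotient_norm l n x \<le> wiener_norm (representative l n x g)"
  unfolding quotient_norm_eq
proof (rule cINF_lower)
  show "bdd_below ((\<lambda>g. wiener_norm (representative l n x g)) ` wiener_algebra)"
    by (rule bdd_belowI2[where m = 0])
       (intro wiener_norm_nonneg representative_in_wiener assms)
qed fact

lemma le_quotient_norm:
  assumes "\<And>g. g \<in> wiener_algebra \<Longrightarrow> c \<le> wiener_norm (representative l n x g)"
  shows "c \<le> quotient_norm l n x"
proof -
  have "wiener_algebra \<noteq> {}" using wiener_const by blast
  thus ?thesis unfolding quotient_norm_eq using assms by (rule cINF_greatest)
qed

text \<open>
  The duality principle for the quotient norm: a functional of the coordinates that is given by a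
  kernel with small moments forces the quotient norm to be large.
\<close>

lemma coordinate_functional_bound:
  assumes l: "0 < l" "l < 1" and "0 < M"
    and K: "K holomorphic_on ball 0 (1 / l) - {of_real l}"
    and moments: "\<And>k. norm (contour_integral (circlepath 0 1) (\<lambda>z. z ^ k * K z)) \<le> M"
    and c: "\<And>g r. g \<in> wiener_algebra \<Longrightarrow> l < r \<Longrightarrow> r < 1 \<Longrightarrow>
              ((\<lambda>z. representative l n x g z * K z) has_contour_integral 2 * of_real pi * \<i> * c) (circlepath 0 r)"
  shows "norm c \<le> M * quotient_norm l n x"
proof -
  have "norm c / M \<le> quotient_norm l n x"
  proof (rule le_quotient_norm)
    fix g assume g: "g \<in> wiener_algebra"
    obtain r where r: "l < r" "r < 1" using dense[OF l(2)] by blast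
    have "norm (2 * of_real pi * \<i> * c) \<le> M * wiener_norm (representative l n x g)"
      using contour_pairing_bound[OF l r K representative_in_wiener[OF l g] moments]
        contour_integral_unique[OF c[OF g r]] by metis
    moreover have "1 * norm c \<le> 2 * pi * norm c"
      using pi_gt3 by (intro mult_right_mono) auto
    ultimately have "norm c \<le> M * wiener_norm (representative l n x g)"
      by (simp add: norm_mult)
    thus "norm c / M \<le> wiener_norm (representative l n x g)"
      using \<open>0 < M\<close> by (simp add: pos_divide_le_eq mult.commute)
  qed
  thus ?thesis using \<open>0 < M\<close> by (simp add: pos_divide_le_eq mult.commute)
qed

text \<open>
  All coordinates are bounded by the quotient norm. This is needed for the supremum in the operator norm
  to be over a bounded set, and for the lower bound in dimensions 1 and 2.
\<close>

lemma coordinate_bound: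
  assumes l: "0 < l" "l < 1" and j: "j < n"
  shows "norm (vec_index x j) \<le> 2 * pi / (1 - l) * quotient_norm l n x"
proof (rule coordinate_functional_bound[OF l])
  show "((\<lambda>z. representative l n x g z * coordinate_kernel l (Suc j) z) has_contour_integral
      2 * of_real pi * \<i> * vec_index x j) (circlepath 0 r)"
    if "g \<in> wiener_algebra" "l < r" "r < 1" for g r
    using coordinate_integral[OF l that(2,3) _ _ that(1), of "Suc j" n x] j by simp
  show hol: "coordinate_kernel l (Suc j) holomorphic_on ball 0 (1 / l) - {of_real l}"
    by (rule coordinate_kernel_holomorphic[OF l])
  show "norm (contour_integral (circlepath 0 1) (\<lambda>z. z ^ k * coordinate_kernel l (Suc j) z)) \<le> 2 * pi / (1 - l)" for k
  proof -
    have "1 < 1 / l" using l by (simp add: field_simps)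
    hence "sphere (0::complex) 1 \<subseteq> ball 0 (1 / l) - {of_real l}" using l by auto
    hence "continuous_on (path_image (circlepath 0 1)) (\<lambda>z. z ^ k * coordinate_kernel l (Suc j) z)"
      using holomorphic_on_imp_continuous_on[OF hol]
      by (auto intro!: continuous_intros intro: continuous_on_subset)
    hence "(\<lambda>z. z ^ k * coordinate_kernel l (Suc j) z) contour_integrable_on circlepath 0 1"
      by (rule contour_integrable_continuous_circlepath)
    from has_contour_integral_bound_circlepath[OF has_contour_integral_integral[OF this], of "1 / (1 - l)"]
    have "(\<And>z. norm (z - 0) = 1 \<Longrightarrow> norm (z ^ k * coordinate_kernel l (Suc j) z) \<le> 1 / (1 - l)) \<Longrightarrow>
        norm (contour_integral (circlepath 0 1) (\<lambda>z. z ^ k * coordinate_kernel l (Suc j) z)) \<le> 1 / (1 - l) * (2 * pi * 1)"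
      using l by simp
    moreover have "norm (z ^ k * coordinate_kernel l (Suc j) z) \<le> 1 / (1 - l)" if "norm (z - 0) = 1" for z
    proof -
      have z: "norm z = 1" using that by simp
      have "sqrt (1 - l\<^sup>2) \<le> 1" "0 \<le> sqrt (1 - l\<^sup>2)" using l by (auto simp: power_le_one)
      moreover have "1 - l \<le> norm (1 - of_real l * z)" by (rule norm_one_minus_mult_ge[OF l]) (simp add: z)
      ultimately have "sqrt (1 - l\<^sup>2) / norm (1 - of_real l * z) \<le> 1 / (1 - l)"
        using l by (intro frac_le) auto
      moreover have "norm (z ^ k * coordinate_kernel l (Suc j) z) = sqrt (1 - l\<^sup>2) / norm (1 - of_real l * z)"
        using norm_blaschke_on_circle[OF l z] z \<open>0 \<le> sqrt (1 - l\<^sup>2)\<close>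
        by (simp add: coordinate_kernel_def norm_mult norm_divide norm_power del: power_Suc)
      ultimately show ?thesis by simp
    qed
    ultimately show ?thesis by simp
  qed
qed (use l in simp)

text \<open>
  The kernels of index n and n - 2 belong to the entries n - 1 and n - 3, since coordinates are counted
  from 1 and vector entries from 0.
\<close>

lemma second_difference_bound:
  assumes l: "0 < l" "l < 1"
  shows "\<exists>C>0. \<forall>n\<ge>3. \<forall>x.
     norm (vec_index x (n - 1) - vec_index x (n - 3)) \<le> C / sqrt (real n) * quotient_norm l n x"
proof -
  obtain C where C: "C > 0" "\<And>n k. n \<ge> 2 \<Longrightarrow> norm (contour_integral (circlepath 0 1)
      (\<lambda>z. z ^ k * (coordinate_kernel l n z - coordinate_kernel l (n - 2) z))) \<le> C / sqrt (real n)"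
    using second_difference_moments[OF l] by blast
  have "norm (vec_index x (n - 1) - vec_index x (n - 3)) \<le> C / sqrt (real n) * quotient_norm l n x"
    if n: "n \<ge> 3" for n x
  proof (rule coordinate_functional_bound[OF l])
    show "((\<lambda>z. representative l n x g z * (coordinate_kernel l n z - coordinate_kernel l (n - 2) z))
        has_contour_integral 2 * of_real pi * \<i> * (vec_index x (n - 1) - vec_index x (n - 3))) (circlepath 0 r)"
      if "g \<in> wiener_algebra" "l < r" "r < 1" for g r
    proof -
      have "n - 2 - 1 = n - 3" by simp
      with has_contour_integral_diff[OF coordinate_integral[OF l that(2,3) _ _ that(1), of n n x]
          coordinate_integral[OF l that(2,3) _ _ that(1), of "n - 2" n x]] n
      show ?thesis by (simp only: right_diff_distrib)
    qed
    show "(\<lambda>z. coordinate_kernel l n z - coordinate_kernel l (n - 2) z) holomorphic_on ball 0 (1 / l) - {of_real l}"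
      by (intro holomorphic_intros coordinate_kernel_holomorphic l)
    show "norm (contour_integral (circlepath 0 1)
        (\<lambda>z. z ^ k * (coordinate_kernel l n z - coordinate_kernel l (n - 2) z))) \<le> C / sqrt (real n)" for k
      using C(2)[of n k] n by simp
  qed (use C n in auto)
  thus ?thesis using C(1) by blast
qed

section \<open>The Toeplitz matrix as multiplication by the variable\<close>

lemma representative_alt:
  "representative l n x g z = (\<Sum>j<n. vec_index x j * basis_fun l (Suc j) z) + blaschke l z ^ n * g z"
  by (simp add: representative_def sum.atLeast1_atMost_eq)

text \<open>
  In the coordinate w = b(z) one has 1 = (1 - l ^ 2) / (1 - l z) * (1 / (1 + l w)); the sum is
  the geometric series for 1 / (1 + l w), cut off at order n.
\<close>

lemma one_expansion:
  assumes l: "0 < l" "l < 1" and z: "norm z < 1"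
  shows "(\<Sum>j<n. of_real (sqrt (1 - l\<^sup>2)) * (- of_real l) ^ j * basis_fun l (Suc j) z)
           + blaschke l z ^ n * (- of_real l) ^ n = 1"
proof (induction n)
  case (Suc n)
  have nz: "1 - of_real l * z \<noteq> 0" using one_minus_mult_nonzero[OF l, of z] z by simp
  have s: "complex_of_real (sqrt (1 - l\<^sup>2)) * of_real (sqrt (1 - l\<^sup>2)) = 1 - of_real l ^ 2"
    using l by (simp flip: of_real_mult add: power_le_one)
  have "of_real (sqrt (1 - l\<^sup>2)) * (- of_real l) ^ n * basis_fun l (Suc n) z
      = (1 - of_real l ^ 2) / (1 - of_real l * z) * ((- of_real l) ^ n * blaschke l z ^ n)"
    unfolding basis_fun_def s[symmetric] by (simp add: mult_ac)
  also have "\<dots> = (1 + of_real l * blaschke l z) * ((- of_real l) ^ n * blaschke l z ^ n)"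
    by (simp only: blaschke_partial_fraction[OF nz])
  also have "\<dots> = blaschke l z ^ n * (- of_real l) ^ n - blaschke l z ^ Suc n * (- of_real l) ^ Suc n"
    by (simp add: algebra_simps)
  finally show ?case using Suc.IH by simp
qed simp

text \<open>
  In the coordinate w = b(z) the variable is z = (w + l) / (1 + l w), whose power series in w has the
  coefficients of the first column of the Toeplitz matrix. So the matrix represents multiplication by z
  modulo b ^ n, and the remainder is a constant multiple of b ^ n.
\<close>

lemma shift_expansion:
  assumes l: "0 < l" "l < 1" and z: "norm z < 1" and "j < n"
  shows "z * basis_fun l (Suc j) z =
    (\<Sum>i<n. (if i = j then of_real l
             else if i > j then (- of_real l) ^ (i - j - 1) * (1 - (of_real l)\<^sup>2) else 0) * basis_fun l (Suc i) z)
    + blaschke l z ^ n * (of_real (sqrt (1 - l\<^sup>2)) * (- of_real l) ^ (n - Suc j))"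
  using Suc_leI[OF \<open>j < n\<close>]
proof (induction n rule: dec_induct)
  case base
  have "(\<Sum>i<Suc j. (if i = j then of_real l
             else if i > j then (- of_real l) ^ (i - j - 1) * (1 - (of_real l)\<^sup>2) else 0) * basis_fun l (Suc i) z)
      = (of_real l :: complex) * basis_fun l (Suc j) z"
    by (simp add: sum.neutral)
  moreover have "(z - of_real l) * basis_fun l (Suc j) z = blaschke l z ^ Suc j * of_real (sqrt (1 - l\<^sup>2))"
    by (simp add: basis_fun_def) (simp add: blaschke_def)
  ultimately show ?case by (simp add: algebra_simps)
next
  case (step n)
  have nz: "1 - of_real l * z \<noteq> 0" using one_minus_mult_nonzero[OF l, of z] z by simp
  have nj: "Suc n - Suc j = Suc (n - Suc j)" "n - j - 1 = n - Suc j" "n \<noteq> j" "j < n" using step(1) by auto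
  have "(- of_real l) ^ (n - Suc j) * (1 - (of_real l)\<^sup>2) * basis_fun l (Suc n) z =
     of_real (sqrt (1 - l\<^sup>2)) * (- of_real l) ^ (n - Suc j) * blaschke l z ^ n * ((1 - of_real l ^ 2) / (1 - of_real l * z))"
    by (simp add: basis_fun_def)
  also have "\<dots> = of_real (sqrt (1 - l\<^sup>2)) * (- of_real l) ^ (n - Suc j) * blaschke l z ^ n * (1 + of_real l * blaschke l z)"
    by (simp only: blaschke_partial_fraction[OF nz])
  also have "\<dots> = blaschke l z ^ n * (of_real (sqrt (1 - l\<^sup>2)) * (- of_real l) ^ (n - Suc j))
       - blaschke l z ^ Suc n * (of_real (sqrt (1 - l\<^sup>2)) * (- of_real l) ^ (Suc n - Suc j))"
    unfolding nj(1) by (simp add: algebra_simps)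
  finally show ?case using step.IH nj by simp
qed

lemma toeplitz_mult_vec:
  assumes "x \<in> carrier_vec n" "i < n"
  shows "vec_index (toeplitz l n *\<^sub>v x) i =
    (\<Sum>j<n. (if i = j then of_real l
             else if i > j then (- of_real l) ^ (i - j - 1) * (1 - (of_real l)\<^sup>2) else 0) * vec_index x j)"
  using assms by (simp add: toeplitz_def scalar_prod_def lessThan_atLeast0 cong: if_cong)

text \<open>
  Multiplication by z maps representatives of x to representatives of the image of x, without changing
  their Wiener norm.
\<close>

lemma quotient_norm_toeplitz_le:
  assumes l: "0 < l" "l < 1" and x: "x \<in> carrier_vec n"
  shows "quotient_norm l n (toeplitz l n *\<^sub>v x) \<le> quotient_norm l n x"
proof (rule le_quotient_norm)
  fix g assume g: "g \<in> wiener_algebra"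
  define c where "c = (\<Sum>j<n. vec_index x j * (of_real (sqrt (1 - l\<^sup>2)) * (- of_real l) ^ (n - Suc j)))"
  let ?g = "\<lambda>z. z * g z + c"
  have g': "?g \<in> wiener_algebra" by (intro wiener_add wiener_shift wiener_const g)
  have eq: "representative l n (toeplitz l n *\<^sub>v x) ?g z = z * representative l n x g z"
    if "z \<in> ball 0 1" for z
  proof -
    have z: "norm z < 1" using that by simp
    let ?T = "\<lambda>i j. if i = j then complex_of_real l
             else if i > j then (- of_real l) ^ (i - j - 1) * (1 - (of_real l)\<^sup>2) else 0"
    have "z * (\<Sum>j<n. vec_index x j * basis_fun l (Suc j) z)
        = (\<Sum>j<n. vec_index x j * (z * basis_fun l (Suc j) z))"
      by (simp add: sum_distrib_left mult_ac)
    also have "\<dots> = (\<Sum>j<n. vec_index x j * ((\<Sum>i<n. ?T i j * basis_fun l (Suc i) z)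
         + blaschke l z ^ n * (of_real (sqrt (1 - l\<^sup>2)) * (- of_real l) ^ (n - Suc j))))"
      by (intro sum.cong refl arg_cong2[of _ _ _ _ "(*)"] shift_expansion l z) simp
    also have "\<dots> = (\<Sum>j<n. \<Sum>i<n. ?T i j * vec_index x j * basis_fun l (Suc i) z) + blaschke l z ^ n * c"
      unfolding c_def distrib_left sum.distrib sum_distrib_left by (simp only: mult_ac)
    also have "(\<Sum>j<n. \<Sum>i<n. ?T i j * vec_index x j * basis_fun l (Suc i) z)
        = (\<Sum>i<n. \<Sum>j<n. ?T i j * vec_index x j * basis_fun l (Suc i) z)"
      by (rule sum.swap)
    also have "\<dots> = (\<Sum>i<n. vec_index (toeplitz l n *\<^sub>v x) i * basis_fun l (Suc i) z)"
      by (intro sum.cong refl) (simp only: toeplitz_mult_vec[OF x] lessThan_iff sum_distrib_right)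
    finally have "z * (\<Sum>j<n. vec_index x j * basis_fun l (Suc j) z) =
       (\<Sum>i<n. vec_index (toeplitz l n *\<^sub>v x) i * basis_fun l (Suc i) z) + blaschke l z ^ n * c" .
    thus ?thesis by (simp add: representative_alt distrib_left mult.left_commute)
  qed
  have "quotient_norm l n (toeplitz l n *\<^sub>v x) \<le> wiener_norm (representative l n (toeplitz l n *\<^sub>v x) ?g)"
    by (rule quotient_norm_le[OF l g'])
  also have "\<dots> = wiener_norm (\<lambda>z. z * representative l n x g z)"
    by (rule wiener_norm_cong) (rule eq)
  also have "\<dots> = wiener_norm (representative l n x g)"
    by (rule wiener_norm_shift[OF representative_in_wiener[OF l g]])
  finally show "quotient_norm l n (toeplitz l n *\<^sub>v x) \<le> wiener_norm (representative l n x g)" .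
qed

lemma quotient_norm_zero_le:
  assumes "0 < l" "l < 1"
  shows "quotient_norm l n (0\<^sub>v n) \<le> 0"
proof -
  have "wiener_norm (representative l n (0\<^sub>v n) (\<lambda>z. 0)) = wiener_norm (\<lambda>z. 0)"
    by (rule wiener_norm_cong) (simp add: representative_alt)
  thus ?thesis
    using quotient_norm_le[OF assms wiener_const[of 0], of n "0\<^sub>v n"] by (simp add: wiener_norm_const)
qed

lemma induced_norm_toeplitz_le:
  assumes l: "0 < l" "l < 1"
  shows "induced_norm l n (toeplitz l n) \<le> 1"
  unfolding induced_norm_def
proof (rule cSUP_least)
  have "0\<^sub>v n \<in> {x \<in> carrier_vec n. quotient_norm l n x \<le> 1}"
    using quotient_norm_zero_le[OF l, of n] by simp
  thus "{x \<in> carrier_vec n. quotient_norm l n x \<le> 1} \<noteq> {}" by blast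
next
  fix x assume "x \<in> {x \<in> carrier_vec n. quotient_norm l n x \<le> 1}"
  thus "quotient_norm l n (toeplitz l n *\<^sub>v x) \<le> 1"
    using quotient_norm_toeplitz_le[OF l, of x n] by auto
qed

text \<open>
  A supremum of real numbers is an upper bound only if the set is bounded above. Here this holds for
  every matrix, since the quotient norm controls each coordinate and is controlled by them.
\<close>

lemma quotient_norm_le_induced_norm:
  assumes l: "0 < l" "l < 1" and A: "A \<in> carrier_mat n n"
    and x: "x \<in> carrier_vec n" "quotient_norm l n x \<le> 1"
  shows "quotient_norm l n (A *\<^sub>v x) \<le> induced_norm l n A"
  unfolding induced_norm_def
proof (rule cSUP_upper)
  define D where "D = 2 * pi / (1 - l)"
  have "0 \<le> D" using l by (simp add: D_def)
  show "bdd_above ((\<lambda>x. quotient_norm l n (A *\<^sub>v x)) ` {x \<in> carrier_vec n. quotient_norm l n x \<le> 1})"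
  proof (rule bdd_aboveI2)
    fix v assume v: "v \<in> {x \<in> carrier_vec n. quotient_norm l n x \<le> 1}"
    have v_le: "norm (vec_index v j) \<le> D" if "j < n" for j
      using coordinate_bound[OF l that, of v] v mult_left_le[of "quotient_norm l n v" D] \<open>0 \<le> D\<close>
      unfolding D_def by auto
    have Av: "norm (vec_index (A *\<^sub>v v) i) \<le> (\<Sum>j<n. norm (A $$ (i, j)) * D)" if "i < n" for i
    proof -
      have "vec_index (A *\<^sub>v v) i = (\<Sum>j<n. A $$ (i, j) * vec_index v j)"
        using A v that by (auto simp: scalar_prod_def lessThan_atLeast0 intro!: sum.cong)
      thus ?thesis
        by (auto simp: norm_mult intro!: sum_norm_le mult_left_mono v_le)
    qed
    have "quotient_norm l n (A *\<^sub>v v) \<le> wiener_norm (representative l n (A *\<^sub>v v) (\<lambda>z. 0))"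
      by (rule quotient_norm_le[OF l wiener_const])
    also have "\<dots> = wiener_norm (\<lambda>z. \<Sum>i<n. vec_index (A *\<^sub>v v) i * basis_fun l (Suc i) z)"
      by (rule wiener_norm_cong) (simp add: representative_alt)
    also have "\<dots> \<le> (\<Sum>i<n. norm (vec_index (A *\<^sub>v v) i) * wiener_norm (basis_fun l (Suc i)))"
      by (rule wiener_norm_sum_le) (rule wiener_basis_fun[OF l])
    also have "\<dots> \<le> (\<Sum>i<n. (\<Sum>j<n. norm (A $$ (i, j)) * D) * wiener_norm (basis_fun l (Suc i)))"
      by (intro sum_mono mult_right_mono Av wiener_norm_nonneg wiener_basis_fun l) simp
    finally show "quotient_norm l n (A *\<^sub>v v) \<le> (\<Sum>i<n. (\<Sum>j<n. norm (A $$ (i, j)) * D) * wiener_norm (basis_fun l (Suc i)))" .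
  qed
qed (use x in simp)

section \<open>The resolvent\<close>

text \<open>
  The right-hand side consists of the coordinates of the constant function 1. In the coordinate w = b(z),
  1 = (s / (1 + l w)) * e_1 with s = sqrt (1 - l ^ 2), and \<zeta> - z equals
  (\<zeta> - l) (1 - w / b(\<zeta>)) / (1 + l w); dividing leaves a geometric series in w / b(\<zeta>).
\<close>

lemma resolvent_vector:
  assumes l: "0 < l" "l < 1" and \<zeta>: "norm \<zeta> < 1" "\<zeta> \<noteq> of_real l"
  defines "s \<equiv> complex_of_real (sqrt (1 - l\<^sup>2))"
  shows "(\<zeta> \<cdot>\<^sub>m 1\<^sub>m n - toeplitz l n) *\<^sub>v vec n (\<lambda>j. s / (\<zeta> - of_real l) * (1 / blaschke l \<zeta>) ^ j)
       = vec n (\<lambda>j. s * (- of_real l) ^ j)"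
proof (rule eq_vecI)
  fix i assume "i < dim_vec (vec n (\<lambda>j. s * (- complex_of_real l) ^ j))"
  hence i: "i < n" by simp
  define L where "L = complex_of_real l"
  define u where "u = 1 / blaschke l \<zeta>"
  define y where "y = vec n (\<lambda>j. s / (\<zeta> - L) * u ^ j)"
  have y: "y \<in> carrier_vec n" by (simp add: y_def)
  have nz: "\<zeta> - L \<noteq> 0" "1 - L * \<zeta> \<noteq> 0" "1 - L ^ 2 \<noteq> 0"
    using \<zeta> one_minus_mult_nonzero[OF l, of \<zeta>] one_minus_mult_nonzero[OF l, of "of_real l"] l
    by (auto simp: L_def power2_eq_square)
  have u: "u + L = (1 - L ^ 2) / (\<zeta> - L)"
  proof -
    have "u = (1 - L * \<zeta>) / (\<zeta> - L)" by (simp add: u_def blaschke_def L_def)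
    hence "u + L = (1 - L * \<zeta> + L * (\<zeta> - L)) / (\<zeta> - L)"
      using divide_add_eq_iff[OF nz(1), of "1 - L * \<zeta>" L] by simp
    also have "1 - L * \<zeta> + L * (\<zeta> - L) = 1 - L ^ 2"
      by (simp add: power2_eq_square algebra_simps)
    finally show ?thesis .
  qed
  (* The sum over j < i in row i is a coefficient, of order i - 1, of the product of two geometric series. *)
  have "u ^ i - (- L) ^ i = (u + L) * (\<Sum>j<i. (- L) ^ (i - j - 1) * u ^ j)"
    using power_diff_sumr2[of u i "- L"] by simp
  hence geometric: "(1 - L ^ 2) * (\<Sum>j<i. (- L) ^ (i - j - 1) * u ^ j) = (\<zeta> - L) * (u ^ i - (- L) ^ i)"
    unfolding u using nz by simp
  have "vec_index ((\<zeta> \<cdot>\<^sub>m 1\<^sub>m n - toeplitz l n) *\<^sub>v y) i = \<zeta> * vec_index y i - vec_index (toeplitz l n *\<^sub>v y) i"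
  proof -
    have "vec_index ((\<zeta> \<cdot>\<^sub>m 1\<^sub>m n - toeplitz l n) *\<^sub>v y) i =
        (\<Sum>j<n. (if j = i then \<zeta> * vec_index y i else 0) - toeplitz l n $$ (i, j) * vec_index y j)"
      using i y by (auto simp: scalar_prod_def lessThan_atLeast0 toeplitz_def left_diff_distrib intro!: sum.cong)
    also have "\<dots> = \<zeta> * vec_index y i - (\<Sum>j<n. toeplitz l n $$ (i, j) * vec_index y j)"
      using i by (simp add: sum_subtractf)
    also have "(\<Sum>j<n. toeplitz l n $$ (i, j) * vec_index y j) = vec_index (toeplitz l n *\<^sub>v y) i"
      using i y by (auto simp: scalar_prod_def lessThan_atLeast0 toeplitz_def intro!: sum.cong)
    finally show ?thesis .
  qed
  also have "vec_index (toeplitz l n *\<^sub>v y) i =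
      (\<Sum>j<n. if j = i then L * vec_index y i else if j < i then (- L) ^ (i - j - 1) * (1 - L ^ 2) * vec_index y j else 0)"
    unfolding toeplitz_mult_vec[OF y i] by (intro sum.cong) (auto simp: L_def)
  also have "\<dots> = L * vec_index y i + (\<Sum>j<i. (- L) ^ (i - j - 1) * (1 - L ^ 2) * vec_index y j)"
  proof -
    have "(\<Sum>j<n. if j = i then L * vec_index y i else if j < i then (- L) ^ (i - j - 1) * (1 - L ^ 2) * vec_index y j else 0)
        = (\<Sum>j\<in>insert i {..<i}. if j = i then L * vec_index y i else if j < i then (- L) ^ (i - j - 1) * (1 - L ^ 2) * vec_index y j else 0)"
      using i by (intro sum.mono_neutral_right) auto
    also have "\<dots> = L * vec_index y i + (\<Sum>j<i. (- L) ^ (i - j - 1) * (1 - L ^ 2) * vec_index y j)"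
      by (subst sum.insert) (auto intro!: sum.cong)
    finally show ?thesis .
  qed
  also have "(\<Sum>j<i. (- L) ^ (i - j - 1) * (1 - L ^ 2) * vec_index y j) =
      s / (\<zeta> - L) * ((1 - L ^ 2) * (\<Sum>j<i. (- L) ^ (i - j - 1) * u ^ j))"
    using i by (simp add: y_def sum_distrib_left mult_ac)
  also have "\<dots> = s * (u ^ i - (- L) ^ i)"
    unfolding geometric using nz by simp
  also have "\<zeta> * vec_index y i - (L * vec_index y i + s * (u ^ i - (- L) ^ i)) = (\<zeta> - L) * vec_index y i - s * (u ^ i - (- L) ^ i)"
    by (simp add: algebra_simps)
  also have "(\<zeta> - L) * vec_index y i = s * u ^ i"
    using i nz by (simp add: y_def)
  finally have "vec_index ((\<zeta> \<cdot>\<^sub>m 1\<^sub>m n - toeplitz l n) *\<^sub>v y) i = s * (- L) ^ i"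
    by (simp add: algebra_simps)
  thus "vec_index ((\<zeta> \<cdot>\<^sub>m 1\<^sub>m n - toeplitz l n) *\<^sub>v vec n (\<lambda>j. s / (\<zeta> - of_real l) * (1 / blaschke l \<zeta>) ^ j)) i =
      vec_index (vec n (\<lambda>j. s * (- of_real l) ^ j)) i"
    using i by (simp add: y_def u_def L_def)
qed (simp add: toeplitz_def)

text \<open>
  The vector is that of the constant function 1.
\<close>

lemma quotient_norm_one_le:
  assumes l: "0 < l" "l < 1"
  shows "quotient_norm l n (vec n (\<lambda>j. of_real (sqrt (1 - l\<^sup>2)) * (- of_real l) ^ j)) \<le> 1"
proof -
  let ?x = "vec n (\<lambda>j. complex_of_real (sqrt (1 - l\<^sup>2)) * (- of_real l) ^ j)"
  have "wiener_norm (representative l n ?x (\<lambda>z. (- of_real l) ^ n)) = wiener_norm (\<lambda>z. 1)"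
    by (rule wiener_norm_cong) (use one_expansion[OF l, of _ n] in \<open>simp add: representative_alt\<close>)
  thus ?thesis
    using quotient_norm_le[OF l wiener_const[of "(- of_real l) ^ n"], of n ?x] by (simp add: wiener_norm_const)
qed

text \<open>
  The matrix is triangular with constant nonzero diagonal.
\<close>

lemma resolvent_invertible:
  assumes "\<zeta> \<noteq> of_real l"
  shows "invertible_mat (\<zeta> \<cdot>\<^sub>m 1\<^sub>m n - toeplitz l n)"
    and "\<exists>R. mat_inverse (\<zeta> \<cdot>\<^sub>m 1\<^sub>m n - toeplitz l n) = Some R \<and> R \<in> carrier_mat n n \<and>
           R * (\<zeta> \<cdot>\<^sub>m 1\<^sub>m n - toeplitz l n) = 1\<^sub>m n"
proof -
  define M where "M = \<zeta> \<cdot>\<^sub>m 1\<^sub>m n - toeplitz l n"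
  have M: "M \<in> carrier_mat n n" by (intro carrier_matI) (simp_all add: M_def toeplitz_def)
  have "det M = prod_list (diag_mat M)"
    by (rule det_lower_triangular[OF _ M]) (simp add: M_def toeplitz_def)
  moreover have "diag_mat M = replicate n (\<zeta> - of_real l)"
    by (rule nth_equalityI) (simp_all add: diag_mat_def M_def toeplitz_def)
  ultimately have "det M \<noteq> 0" using assms by simp
  hence unit: "M \<in> Units (ring_mat TYPE(complex) n undefined)"
    by (rule det_non_zero_imp_unit[OF M])
  then obtain R where R: "mat_inverse M = Some R"
    using mat_inverse(1)[OF M, of undefined] by (cases "mat_inverse M") auto
  note inv = mat_inverse(2)[OF M R]
  show "\<exists>R. mat_inverse (\<zeta> \<cdot>\<^sub>m 1\<^sub>m n - toeplitz l n) = Some R \<and> R \<in> carrier_mat n n \<and>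
           R * (\<zeta> \<cdot>\<^sub>m 1\<^sub>m n - toeplitz l n) = 1\<^sub>m n"
    using R inv unfolding M_def by blast
  show "invertible_mat (\<zeta> \<cdot>\<^sub>m 1\<^sub>m n - toeplitz l n)"
    using inv M unfolding invertible_mat_def inverts_mat_def M_def[symmetric] by auto
qed

theorem theorem7:
  fixes l :: real and \<zeta> :: complex
  assumes "0 < l" and "l < 1"
    and "\<zeta> \<in> ball 0 1 - {of_real l}"
  shows "\<exists>d>0. \<forall>n\<ge>1.
    induced_norm l n (toeplitz l n) \<le> 1 \<and>
    invertible_mat (\<zeta> \<cdot>\<^sub>m 1\<^sub>m n - toeplitz l n) \<and>
    norm (blaschke l \<zeta> ^ n) *
      induced_norm l n (the (mat_inverse (\<zeta> \<cdot>\<^sub>m 1\<^sub>m n - toeplitz l n)))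
      \<ge> d * sqrt (real n)"
proof -
  note l = assms(1,2)
  have \<zeta>: "norm \<zeta> < 1" "\<zeta> \<noteq> of_real l" using assms(3) by auto
  define \<beta> where "\<beta> = blaschke l \<zeta>"
  define c where "c = complex_of_real (sqrt (1 - l\<^sup>2)) / (\<zeta> - of_real l)"
  define y where "y n = vec n (\<lambda>j. c * (1 / \<beta>) ^ j)" for n
  have \<beta>: "\<beta> \<noteq> 0" using blaschke_eq_0_iff[OF l, of \<zeta>] \<zeta> by (simp add: \<beta>_def)
  have "norm \<beta> < 1" unfolding \<beta>_def by (rule norm_blaschke_less_one[OF l \<zeta>(1)])
  hence "norm (\<beta>\<^sup>2) < 1" by (simp add: norm_power power_less_one_iff)
  hence \<beta>2: "norm (1 - \<beta>\<^sup>2) > 0" by auto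
  have c: "norm c > 0" using l \<zeta> by (auto simp: c_def power_less_one_iff abs_square_eq_1)
  have resolvent: "quotient_norm l n (y n) \<le> induced_norm l n (the (mat_inverse (\<zeta> \<cdot>\<^sub>m 1\<^sub>m n - toeplitz l n)))" for n
  proof -
    obtain R where R: "mat_inverse (\<zeta> \<cdot>\<^sub>m 1\<^sub>m n - toeplitz l n) = Some R" "R \<in> carrier_mat n n"
      "R * (\<zeta> \<cdot>\<^sub>m 1\<^sub>m n - toeplitz l n) = 1\<^sub>m n"
      using resolvent_invertible(2)[OF \<zeta>(2), of n] by blast
    define M where "M = \<zeta> \<cdot>\<^sub>m 1\<^sub>m n - toeplitz l n"
    define X where "X = vec n (\<lambda>j. complex_of_real (sqrt (1 - l\<^sup>2)) * (- of_real l) ^ j)"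
    have M: "M \<in> carrier_mat n n" by (intro carrier_matI) (simp_all add: M_def toeplitz_def)
    have y: "y n \<in> carrier_vec n" by (simp add: y_def)
    have "M *\<^sub>v y n = X"
      unfolding M_def y_def X_def c_def \<beta>_def by (rule resolvent_vector[OF l \<zeta>])
    hence "R *\<^sub>v X = (R * M) *\<^sub>v y n" using assoc_mult_mat_vec[OF R(2) M y] by simp
    also have "\<dots> = y n" using R(3) y by (simp add: M_def)
    finally have "R *\<^sub>v X = y n" .
    moreover have "quotient_norm l n (R *\<^sub>v X) \<le> induced_norm l n R"
      by (rule quotient_norm_le_induced_norm[OF l R(2)])
         (use quotient_norm_one_le[OF l, of n] in \<open>simp_all add: X_def\<close>)
    ultimately show ?thesis using R(1) by simp
  qed
  obtain C where C: "C > 0" "\<And>n x. n \<ge> 3 \<Longrightarrow>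
      norm (vec_index x (n - 1) - vec_index x (n - 3)) \<le> C / sqrt (real n) * quotient_norm l n x"
    using second_difference_bound[OF l] by blast
  define d1 where "d1 = norm \<beta> * norm c * norm (1 - \<beta>\<^sup>2) / C"
  define d2 where "d2 = norm \<beta> * norm c * (1 - l) / (2 * pi * sqrt 2)"
  (* The entries of y n grow like 1 / \<beta> ^ j, so that the factor \<beta> ^ n exactly compensates the
     size of the last entries. *)
  have large: "d1 * sqrt (real n) \<le> norm (\<beta> ^ n) * quotient_norm l n (y n)" if n: "n \<ge> 3" for n
  proof -
    obtain m where m: "n = m + 3" using n by (metis add.commute le_Suc_ex)
    have "\<beta> ^ n * (vec_index (y n) (n - 1) - vec_index (y n) (n - 3)) = \<beta> * c * (1 - \<beta>\<^sup>2)"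
      using \<beta> by (simp add: m y_def power_add field_simps eval_nat_numeral)
    hence "norm \<beta> * norm c * norm (1 - \<beta>\<^sup>2) = norm (\<beta> ^ n) * norm (vec_index (y n) (n - 1) - vec_index (y n) (n - 3))"
      by (metis norm_mult)
    also have "\<dots> \<le> norm (\<beta> ^ n) * (C / sqrt (real n) * quotient_norm l n (y n))"
      by (intro mult_left_mono C(2) n) simp
    finally have "norm \<beta> * norm c * norm (1 - \<beta>\<^sup>2) \<le> norm (\<beta> ^ n) * quotient_norm l n (y n) * (C / sqrt (real n))"
      by (simp add: mult_ac)
    thus ?thesis using C(1) n by (simp add: d1_def field_simps)
  qed
  (* There is no entry n - 3 when n < 3; the last entry alone then bounds the norm from below. *)
  have small: "d2 * sqrt (real n) \<le> norm (\<beta> ^ n) * quotient_norm l n (y n)" if n: "1 \<le> n" "n < 3" for n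
  proof -
    have "\<beta> ^ n * vec_index (y n) (n - 1) = \<beta> * c"
      using \<beta> n by (cases n) (simp_all add: y_def power_one_over)
    hence "norm \<beta> * norm c = norm (\<beta> ^ n) * norm (vec_index (y n) (n - 1))"
      by (metis norm_mult)
    also have "\<dots> \<le> norm (\<beta> ^ n) * (2 * pi / (1 - l) * quotient_norm l n (y n))"
      using n by (intro mult_left_mono coordinate_bound[OF l]) auto
    finally have *: "norm \<beta> * norm c * (1 - l) / (2 * pi) \<le> norm (\<beta> ^ n) * quotient_norm l n (y n)"
      using l by (simp add: field_simps)
    have "d2 * sqrt (real n) \<le> d2 * sqrt 2"
      using n l by (intro mult_left_mono) (auto simp: d2_def)
    also have "\<dots> = norm \<beta> * norm c * (1 - l) / (2 * pi)" by (simp add: d2_def)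
    finally show ?thesis using * by simp
  qed
  have "0 < min d1 d2"
    using \<beta> \<beta>2 c C(1) l by (simp add: d1_def d2_def)
  moreover have "min d1 d2 * sqrt (real n) \<le>
      norm (blaschke l \<zeta> ^ n) * induced_norm l n (the (mat_inverse (\<zeta> \<cdot>\<^sub>m 1\<^sub>m n - toeplitz l n)))"
    if "n \<ge> 1" for n
  proof -
    have le: "min d1 d2 * sqrt (real n) \<le> d1 * sqrt (real n)" "min d1 d2 * sqrt (real n) \<le> d2 * sqrt (real n)"
      by (intro mult_right_mono; simp)+
    have "min d1 d2 * sqrt (real n) \<le> norm (\<beta> ^ n) * quotient_norm l n (y n)"
      by (cases "n < 3") (use order_trans[OF le(1) large] order_trans[OF le(2) small] that in auto)
    also have "\<dots> \<le> norm (\<beta> ^ n) * induced_norm l n (the (mat_inverse (\<zeta> \<cdot>\<^sub>m 1\<^sub>m n - toeplitz l n)))"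
      by (intro mult_left_mono resolvent) simp
    finally show ?thesis by (simp add: \<beta>_def)
  qed
  ultimately show ?thesis
    using induced_norm_toeplitz_le[OF l] resolvent_invertible(1)[OF \<zeta>(2)] by blast
qed

end
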